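(* Let $M$ be a punctured torus bundle over the circle with Anosov monodromy, with monodromy triangulation $\mathcal T=\{\mathcal T_1,\dots,\mathcal T_N\}$. Let $\mathcal V_+$ be the set of real solutions $(z_j)\in(\mathbb R\setminus\{0,1\})^N$ to Thurston's equations for $(M,\mathcal T)$ with $z_j>0$ for all $j$, and let $\mathcal F$ be a transversely hyperbolic foliation on $(M,\mathcal T)$ determined by a point of $\mathcal V_+$. Then there exist hyperbolic structures $\mathscr H_t$ and $\mathrm{AdS}$ structures $\mathscr A_t$ on $(M,\mathcal T)$, defined for $t>0$, such that $\mathscr H_t$ and $\mathscr A_t$ collapse to $\mathcal F$ as $t\to0$.
   Context: Monodromy triangulation. Let $T=(\mathbb R^2\setminus\mathbb Z^2)/\mathbb Z^2$ and let $\phi\in \mathrm{SL}(2,\mathbb Z)$ be Anosov (distinct real eigenvalues). $M=T\times[0,1]/(x,0)\sim(\phi x,1)$. If $\phi$ has positive eigenvalues, then after conjugation $\phi=W:=R^{m_1}L^{n_1}\cdots R^{m_k}L^{n_k}$ with all $m_i,n_i\ge1$, $R=\begin{pmatrix}1&1\\0&1\end{pmatrix}$, $L=\begin{pmatrix}1&0\\1&1\end{pmatrix}$; if $\phi$ has negative eigenvalues the same is done with $-\phi$, leading to the same equations. Let $W=w_1\cdots w_N$ ($w_i\in\{R,L\}$), $W_k=w_1\cdots w_k$. Let $\Delta_0$ be the ideal triangulation of $T$ with edges in directions $(1,0),(0,1),(-1,1)$ and $\Delta_k=W_k\Delta_0$. $\Delta_{k-1},\Delta_k$ differ by a diagonal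 exchange, realized by an ideal tetrahedron $\mathcal T_k$ with bottom faces $\Delta_{k-1}$ and top faces $\Delta_k$; stacking $\mathcal T_1,\dots,\mathcal T_N$ and gluing $\Delta_N=\phi\Delta_0$ to $\Delta_0$ by $\phi$ gives $M$ with its monodromy triangulation. Thurston's equations. Let $\mathcal B$ be $\mathbb R$, $\mathbb C$, or the pseudo-complex numbers $\mathbb R+\mathbb R\tau$, $\tau^2=+1$, with $|a+b\tau|^2=a^2-b^2$. A shape parameter is $z\in\mathcal B$ with $|z|^2>0$ and $|1-z|^2>0$ (for $\mathbb R,\mathbb C$: $z\ne0,1$). To $\mathcal T_j$ one assigns a shape parameter $z_j$, carried by the two opposite edges exchanged by the diagonal exchange; the other pairs of opposite edges carry $x_j=\frac{z_j-1}{z_j}$ and $y_j=\frac1{1-z_j}$. Indices are cyclic modulo $N$. The edge holonomies are: for every maximal string of consecutive $R$'s in positions $j,\dots,k$ of $W$: $g_j=z_{j-1}x_j^2\cdots x_{k+1}^2z_{k+2}$ and $g_q=z_{q-1}y_q^2z_{q+1}$ for $q=j+1,\dots,k$; for every maximal string of $L$'s in positions $j,\dots,k$: $g_j=z_{j-1}y_j^2\cdots y_{k+1}^2z_{k+2}$ and $g_q=z_{q-1}x_q^2z_{q+1}$ for $q=j+1,\dots,k$. Thurston's equations over $\mathcal B$ require $g_1=\dots=g_N=1$ together with the condition that each edge has total dihedral angle $2\pi$: over $\mathbb C$ (for shape parameters of positive imaginary part) the arguments in $(0,\pi)$ of the factors of each $g_j$ sum to $2\pi$; over $\mathbb R$,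 exactly two factors of each $g_j$ (with multiplicity) are negative; over $\mathbb R+\mathbb R\tau$, exactly two factors of each $g_j$ (with multiplicity) have negative real part. Structures. A solution over $\mathbb R$ determines a transversely hyperbolic foliation on $(M,\mathcal T)$: the lifted tetrahedra in $\widetilde M$ are mapped by submersions onto ideal quadrilaterals in $\mathbb H^2$ with the given real cross ratios, fitting together to an equivariant local submersion $\widetilde M\to\mathbb H^2$. A solution over $\mathbb C$ (resp. $\mathbb R+\mathbb R\tau$) with all $z_j$ of positive imaginary part (coefficient of $i$, resp. $\tau$) determines a hyperbolic (resp. anti de Sitter, $\mathrm{AdS}$) structure on $M$, obtained by gluing positively oriented ideal tetrahedra of $\mathbb H^3$ (resp. $\mathrm{AdS}^3$) with these shape parameters; these are the hyperbolic (resp. $\mathrm{AdS}$) structures on $(M,\mathcal T)$. A path of such structures $\mathscr H_t$ or $\mathscr A_t$ ($t>0$) collapses to $\mathcal F$ as $t\to0$ if it is given by a continuous path of such solutions whose shape parameters converge, as $t\to0$, to the real shape parameters determining $\mathcal F$. *)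

theory Defs
  imports "HOL-Analysis.Analysis"
begin

section \<open>The pseudo-complex numbers\<close>

text \<open>The ring of all \<open>a + b \<tau>\<close> with \<open>\<tau>\<^sup>2 = 1\<close>. It has zero divisors, so it is a
  commutative ring with a partial inverse, not a field.\<close>

datatype pcomplex = PComplex (pRe: real) (pIm: real)

lemma pcomplex_eq_iff: "x = y \<longleftrightarrow> pRe x = pRe y \<and> pIm x = pIm y"
  by (cases x; cases y) simp

instantiation pcomplex :: comm_ring_1
begin

definition zero_pcomplex :: pcomplex where "0 = PComplex 0 0"
definition one_pcomplex :: pcomplex where "1 = PComplex 1 0"
definition plus_pcomplex :: "pcomplex \<Rightarrow> pcomplex \<Rightarrow> pcomplex"
  where "x + y = PComplex (pRe x + pRe y) (pIm x + pIm y)"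
definition minus_pcomplex :: "pcomplex \<Rightarrow> pcomplex \<Rightarrow> pcomplex"
  where "x - y = PComplex (pRe x - pRe y) (pIm x - pIm y)"
definition uminus_pcomplex :: "pcomplex \<Rightarrow> pcomplex"
  where "- x = PComplex (- pRe x) (- pIm x)"
definition times_pcomplex :: "pcomplex \<Rightarrow> pcomplex \<Rightarrow> pcomplex"
  where "x * y = PComplex (pRe x * pRe y + pIm x * pIm y) (pRe x * pIm y + pIm x * pRe y)"

instance
  by standard
    (simp_all add: pcomplex_eq_iff zero_pcomplex_def one_pcomplex_def plus_pcomplex_def
      minus_pcomplex_def uminus_pcomplex_def times_pcomplex_def algebra_simps)

end

text \<open>The square modulus \<open>|a + b \<tau>|\<^sup>2 = a\<^sup>2 - b\<^sup>2\<close>, which may be negative.\<close>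

definition psqmod :: "pcomplex \<Rightarrow> real"
  where "psqmod z = (pRe z)\<^sup>2 - (pIm z)\<^sup>2"

text \<open>The inverse is the conjugate divided by the square modulus; it is \<open>0\<close> by convention when
  the square modulus vanishes.\<close>

instantiation pcomplex :: inverse
begin

definition inverse_pcomplex :: "pcomplex \<Rightarrow> pcomplex"
  where "inverse z = PComplex (pRe z / psqmod z) (- pIm z / psqmod z)"
definition divide_pcomplex :: "pcomplex \<Rightarrow> pcomplex \<Rightarrow> pcomplex"
  where "divide_pcomplex x y = x * inverse y"

instance ..

end

lemma pcomplex_right_inverse:
  fixes z :: pcomplex
  assumes "psqmod z \<noteq> 0"
  shows "z * inverse z = 1"
proof -
  have "pRe z * (pRe z / psqmod z) + pIm z * (- pIm z / psqmod z) = psqmod z / psqmod z"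
    unfolding psqmod_def power2_eq_square diff_divide_distrib by simp
  then show ?thesis
    using assms
    by (simp add: pcomplex_eq_iff times_pcomplex_def inverse_pcomplex_def one_pcomplex_def)
qed

instantiation pcomplex :: real_algebra_1
begin

definition scaleR_pcomplex :: "real \<Rightarrow> pcomplex \<Rightarrow> pcomplex"
  where "scaleR r x = PComplex (r * pRe x) (r * pIm x)"

instance
  by standard
    (simp_all add: pcomplex_eq_iff plus_pcomplex_def times_pcomplex_def scaleR_pcomplex_def
      algebra_simps)

end

text \<open>The norm below only serves to give the pseudo-complex numbers the topology of the real
  plane; the 1-norm is chosen because it is submultiplicative. It is unrelated to the indefinite
  square modulus \<^const>\<open>psqmod\<close>.\<close>

instantiation pcomplex :: real_normed_algebra_1
begin

definition norm_pcomplex :: "pcomplex \<Rightarrow> real"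
  where "norm x = \<bar>pRe x\<bar> + \<bar>pIm x\<bar>"
definition sgn_pcomplex :: "pcomplex \<Rightarrow> pcomplex"
  where "sgn (x::pcomplex) = x /\<^sub>R norm x"
definition dist_pcomplex :: "pcomplex \<Rightarrow> pcomplex \<Rightarrow> real"
  where "dist (x::pcomplex) y = norm (x - y)"
definition uniformity_pcomplex :: "(pcomplex \<times> pcomplex) filter"
  where "(uniformity :: (pcomplex \<times> pcomplex) filter) =
    (INF e\<in>{0 <..}. principal {(x, y). dist x y < e})"
definition open_pcomplex :: "pcomplex set \<Rightarrow> bool"
  where "open (U :: pcomplex set) \<longleftrightarrow>
    (\<forall>x\<in>U. eventually (\<lambda>(x', y). x' = x \<longrightarrow> y \<in> U) uniformity)"

instance
proof
  fix r :: real and x y :: pcomplex and S :: "pcomplex set"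
  show "(norm x = 0) = (x = 0)"
    by (auto simp: norm_pcomplex_def pcomplex_eq_iff zero_pcomplex_def)
  show "norm (x + y) \<le> norm x + norm y"
    by (simp add: norm_pcomplex_def plus_pcomplex_def)
  show "norm (r *\<^sub>R x) = \<bar>r\<bar> * norm x"
    by (simp add: norm_pcomplex_def scaleR_pcomplex_def abs_mult algebra_simps)
  have "\<bar>pRe x * pRe y + pIm x * pIm y\<bar> \<le> \<bar>pRe x\<bar> * \<bar>pRe y\<bar> + \<bar>pIm x\<bar> * \<bar>pIm y\<bar>"
    "\<bar>pRe x * pIm y + pIm x * pRe y\<bar> \<le> \<bar>pRe x\<bar> * \<bar>pIm y\<bar> + \<bar>pIm x\<bar> * \<bar>pRe y\<bar>"
    by (metis abs_mult abs_triangle_ineq)+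
  then show "norm (x * y) \<le> norm x * norm y"
    by (simp add: norm_pcomplex_def times_pcomplex_def algebra_simps)
  show "norm (1::pcomplex) = 1"
    by (simp add: norm_pcomplex_def one_pcomplex_def)
qed (rule sgn_pcomplex_def dist_pcomplex_def open_pcomplex_def uniformity_pcomplex_def)+

end

lemma of_real_pcomplex: "of_real r = PComplex r 0"
  by (simp add: of_real_def scaleR_pcomplex_def one_pcomplex_def)


section \<open>Anosov monodromy and the word of the monodromy triangulation\<close>

definition real_eigenvalue :: "int^2^2 \<Rightarrow> real \<Rightarrow> bool" where
  "real_eigenvalue A l \<longleftrightarrow> (\<exists>v::real^2. v \<noteq> 0 \<and> map_matrix of_int A *v v = l *\<^sub>R v)"

definition anosov :: "int^2^2 \<Rightarrow> bool" where
  "anosov \<phi> \<longleftrightarrow> det \<phi> = 1 \<and> (\<exists>a b. a \<noteq> b \<and> real_eigenvalue \<phi> a \<and> real_eigenvalue \<phi> b)"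

datatype letter = R | L

fun letter_matrix :: "letter \<Rightarrow> int^2^2" where
  "letter_matrix R = vector [vector [1, 1], vector [0, 1]]"
| "letter_matrix L = vector [vector [1, 0], vector [1, 1]]"

definition word_matrix :: "letter list \<Rightarrow> int^2^2" where
  "word_matrix w = foldr (\<lambda>c A. letter_matrix c ** A) w (mat 1)"

text \<open>The words \<open>R\<^bsup>m\<^sub>1\<^esup> L\<^bsup>n\<^sub>1\<^esup> \<dots> R\<^bsup>m\<^sub>k\<^esup> L\<^bsup>n\<^sub>k\<^esup>\<close> with \<open>k \<ge> 1\<close> and all exponents positive.\<close>

definition RL_word :: "letter list \<Rightarrow> bool" where
  "RL_word w \<longleftrightarrow> (\<exists>ps. ps \<noteq> [] \<and> (\<forall>(m, n)\<in>set ps. m \<ge> 1 \<and> n \<ge> 1) \<and>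
     w = concat (map (\<lambda>(m, n). replicate m R @ replicate n L) ps))"

definition SL2_conjugate :: "int^2^2 \<Rightarrow> int^2^2 \<Rightarrow> bool" where
  "SL2_conjugate A B \<longleftrightarrow> (\<exists>P. det P = 1 \<and> P ** A = B ** P)"

definition monodromy_word :: "int^2^2 \<Rightarrow> letter list \<Rightarrow> bool" where
  "monodromy_word \<phi> w \<longleftrightarrow> RL_word w \<and>
     ((\<forall>l. real_eigenvalue \<phi> l \<longrightarrow> l > 0) \<and> SL2_conjugate \<phi> (word_matrix w) \<or>
      (\<forall>l. real_eigenvalue \<phi> l \<longrightarrow> l < 0) \<and> SL2_conjugate (- \<phi>) (word_matrix w))"


section \<open>Edge holonomies\<close>

text \<open>Letters, tetrahedra and edges are indexed by \<open>0, \<dots>, N - 1\<close> with \<open>N = length w\<close>, cyclically.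
  A family of shape parameters is a function on \<open>nat\<close> of which only the values at indices below
  \<open>N\<close> matter.\<close>

definition shape_x :: "'a::{comm_ring_1, inverse} \<Rightarrow> 'a" where
  "shape_x z = (z - 1) / z"

definition shape_y :: "'a::{comm_ring_1, inverse} \<Rightarrow> 'a" where
  "shape_y z = 1 / (1 - z)"

definition cyc :: "letter list \<Rightarrow> (nat \<Rightarrow> 'a) \<Rightarrow> nat \<Rightarrow> 'a" where
  "cyc w z i = z (i mod length w)"

definition cyc_pred :: "letter list \<Rightarrow> (nat \<Rightarrow> 'a) \<Rightarrow> nat \<Rightarrow> 'a" where
  "cyc_pred w z i = cyc w z (i + length w - 1)"

text \<open>Since the words considered begin with \<open>R\<close> and end with \<open>L\<close>, no maximal string of equal
  letters wraps around the end of the word.\<close>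

definition string_start :: "letter list \<Rightarrow> nat \<Rightarrow> bool" where
  "string_start w q \<longleftrightarrow> q = 0 \<or> w ! (q - 1) \<noteq> w ! q"

definition string_end :: "letter list \<Rightarrow> nat \<Rightarrow> nat" where
  "string_end w q = (LEAST k. q \<le> k \<and> (Suc k = length w \<or> w ! Suc k \<noteq> w ! q))"

text \<open>The factors of the holonomy of the \<open>q\<close>-th edge, with multiplicity: a square contributes
  two factors. They are kept as a list because the angle conditions count or sum over them.\<close>

definition edge_factors ::
    "letter list \<Rightarrow> (nat \<Rightarrow> 'a::{comm_ring_1, inverse}) \<Rightarrow> nat \<Rightarrow> 'a list" where
  "edge_factors w z q =
     (let first = (case w ! q of R \<Rightarrow> shape_x | L \<Rightarrow> shape_y);
          other = (case w ! q of R \<Rightarrow> shape_y | L \<Rightarrow> shape_x);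
          k = string_end w q
      in if string_start w q
         then [cyc_pred w z q]
              @ concat (map (\<lambda>i. [first (cyc w z i), first (cyc w z i)]) [q..<k + 2])
              @ [cyc w z (k + 2)]
         else [cyc_pred w z q, other (cyc w z q), other (cyc w z q), cyc w z (q + 1)])"

definition edge_holonomy ::
    "letter list \<Rightarrow> (nat \<Rightarrow> 'a::{comm_ring_1, inverse}) \<Rightarrow> nat \<Rightarrow> 'a" where
  "edge_holonomy w z q = prod_list (edge_factors w z q)"

definition maximal_string :: "letter list \<Rightarrow> letter \<Rightarrow> nat \<Rightarrow> nat \<Rightarrow> bool" where
  "maximal_string w c j k \<longleftrightarrow> j \<le> k \<and> k < length w \<and> (\<forall>i\<in>{j..k}. w ! i = c) \<and>
     (j = 0 \<or> w ! (j - 1) \<noteq> c) \<and> (Suc k = length w \<or> w ! Suc k \<noteq> c)"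

text \<open>The lemmas below spell the holonomies out for the strings of \<open>R\<close>'s and \<open>L\<close>'s.\<close>

lemma string_end_maximal:
  assumes "maximal_string w c j k" "q \<in> {j..k}"
  shows "string_end w q = k"
  unfolding string_end_def
proof (rule Least_equality)
  show "q \<le> k \<and> (Suc k = length w \<or> w ! Suc k \<noteq> w ! q)"
    using assms by (auto simp: maximal_string_def)
next
  fix i assume i: "q \<le> i \<and> (Suc i = length w \<or> w ! Suc i \<noteq> w ! q)"
  show "k \<le> i"
  proof (rule ccontr)
    assume "\<not> k \<le> i"
    then have "Suc i \<in> {j..k}" "Suc i \<noteq> length w"
      using i assms by (auto simp: maximal_string_def)
    then show False
      using i assms by (auto simp: maximal_string_def)
  qed
qed

lemma prod_list_squares:
  fixes f :: "nat \<Rightarrow> 'a::comm_ring_1"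
  shows "prod_list (concat (map (\<lambda>i. [f i, f i]) [a..<b])) = (\<Prod>i\<in>{a..<b}. (f i)\<^sup>2)"
proof -
  have "prod_list (concat (map (\<lambda>i. [f i, f i]) xs)) = prod_list (map (\<lambda>i. (f i)\<^sup>2) xs)" for xs
    by (induction xs) (simp_all add: power2_eq_square mult.assoc)
  then show ?thesis
    using prod.distinct_set_conv_list[of "[a..<b]" "\<lambda>i. (f i)\<^sup>2"] by simp
qed

lemma edge_holonomy_R_first:
  assumes "maximal_string w R j k"
  shows "edge_holonomy w z j =
    cyc_pred w z j * (\<Prod>i\<in>{j..k + 1}. (shape_x (cyc w z i))\<^sup>2) * cyc w z (k + 2)"
proof -
  have s: "string_end w j = k" "w ! j = R" "string_start w j"
    using string_end_maximal[OF assms, of j] assms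
    by (auto simp: maximal_string_def string_start_def)
  have "{j..<k + 2} = {j..k + 1}" by auto
  then show ?thesis
    unfolding edge_holonomy_def edge_factors_def Let_def s
    using prod_list_squares[of "\<lambda>i. shape_x (cyc w z i)" j "k + 2"] s(3)
    by (simp add: mult.assoc del: upt_Suc)
qed

lemma edge_holonomy_L_first:
  assumes "maximal_string w L j k"
  shows "edge_holonomy w z j =
    cyc_pred w z j * (\<Prod>i\<in>{j..k + 1}. (shape_y (cyc w z i))\<^sup>2) * cyc w z (k + 2)"
proof -
  have s: "string_end w j = k" "w ! j = L" "string_start w j"
    using string_end_maximal[OF assms, of j] assms
    by (auto simp: maximal_string_def string_start_def)
  have "{j..<k + 2} = {j..k + 1}" by auto
  then show ?thesis
    unfolding edge_holonomy_def edge_factors_def Let_def s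
    using prod_list_squares[of "\<lambda>i. shape_y (cyc w z i)" j "k + 2"] s(3)
    by (simp add: mult.assoc del: upt_Suc)
qed

lemma not_string_start:
  assumes "maximal_string w c j k" "q \<in> {j<..k}"
  shows "\<not> string_start w q" "w ! q = c"
proof -
  have "q - 1 \<in> {j..k}" "q \<in> {j..k}" "q \<noteq> 0" using assms(2) by auto
  then show "\<not> string_start w q" "w ! q = c"
    using assms(1) unfolding maximal_string_def string_start_def by metis+
qed

lemma edge_holonomy_R_other:
  assumes "maximal_string w R j k" "q \<in> {j<..k}"
  shows "edge_holonomy w z q = cyc_pred w z q * (shape_y (cyc w z q))\<^sup>2 * cyc w z (q + 1)"
  using not_string_start[OF assms]
  by (simp add: edge_holonomy_def edge_factors_def power2_eq_square mult.assoc)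

lemma edge_holonomy_L_other:
  assumes "maximal_string w L j k" "q \<in> {j<..k}"
  shows "edge_holonomy w z q = cyc_pred w z q * (shape_x (cyc w z q))\<^sup>2 * cyc w z (q + 1)"
  using not_string_start[OF assms]
  by (simp add: edge_holonomy_def edge_factors_def power2_eq_square mult.assoc)


section \<open>Thurston's equations\<close>

definition edge_equations :: "letter list \<Rightarrow> (nat \<Rightarrow> 'a::{comm_ring_1, inverse}) \<Rightarrow> bool" where
  "edge_equations w z \<longleftrightarrow> (\<forall>q<length w. edge_holonomy w z q = 1)"

definition real_solution :: "letter list \<Rightarrow> (nat \<Rightarrow> real) \<Rightarrow> bool" where
  "real_solution w z \<longleftrightarrow>
     (\<forall>j<length w. z j \<noteq> 0 \<and> z j \<noteq> 1) \<and> edge_equations w z \<and>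
     (\<forall>q<length w. length (filter (\<lambda>f. f < 0) (edge_factors w z q)) = 2)"

text \<open>For a shape parameter with positive imaginary part all factors have positive imaginary part,
  so \<^const>\<open>Arg\<close>, with values in \<open>(-\<pi>, \<pi>]\<close>, gives the arguments in \<open>(0, \<pi>)\<close>, that is, the
  dihedral angles.\<close>

definition positive_complex_solution :: "letter list \<Rightarrow> (nat \<Rightarrow> complex) \<Rightarrow> bool" where
  "positive_complex_solution w z \<longleftrightarrow>
     (\<forall>j<length w. z j \<noteq> 0 \<and> z j \<noteq> 1) \<and> (\<forall>j<length w. Im (z j) > 0) \<and> edge_equations w z \<and>
     (\<forall>q<length w. sum_list (map Arg (edge_factors w z q)) = 2 * pi)"

definition pcomplex_solution :: "letter list \<Rightarrow> (nat \<Rightarrow> pcomplex) \<Rightarrow> bool" where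
  "pcomplex_solution w z \<longleftrightarrow>
     (\<forall>j<length w. psqmod (z j) > 0 \<and> psqmod (1 - z j) > 0) \<and> edge_equations w z \<and>
     (\<forall>q<length w. length (filter (\<lambda>f. pRe f < 0) (edge_factors w z q)) = 2)"


section \<open>Structures on the triangulated bundle\<close>

text \<open>An ideal tetrahedron (or ideal quadrilateral) is determined up to isometry by its shape
  parameter, and a structure on the triangulated bundle is the result of gluing such pieces. It is
  therefore represented by the shape parameters of its pieces.\<close>

definition V_plus :: "letter list \<Rightarrow> (nat \<Rightarrow> real) set" where
  "V_plus w = {z. real_solution w z \<and> (\<forall>j<length w. z j > 0)}"

definition hyperbolic_structure :: "letter list \<Rightarrow> (nat \<Rightarrow> complex) \<Rightarrow> bool" where
  "hyperbolic_structure w z \<longleftrightarrow> positive_complex_solution w z"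

definition AdS_structure :: "letter list \<Rightarrow> (nat \<Rightarrow> pcomplex) \<Rightarrow> bool" where
  "AdS_structure w z \<longleftrightarrow> pcomplex_solution w z \<and> (\<forall>j<length w. pIm (z j) > 0)"

definition collapses_to ::
    "letter list \<Rightarrow> (real \<Rightarrow> nat \<Rightarrow> 'a::real_normed_algebra_1) \<Rightarrow> (nat \<Rightarrow> real) \<Rightarrow> bool" where
  "collapses_to w Z z \<longleftrightarrow>
     (\<forall>j<length w. continuous_on {0<..} (\<lambda>t. Z t j) \<and>
        ((\<lambda>t. Z t j) \<longlongrightarrow> of_real (z j)) (at_right 0))"

end

theory Submission
  imports Defs
begin

text \<open>Near a positive real solution \<open>F\<close> the solutions of the edge equations, over the reals and over the
complex numbers alike, form a curve \<open>s \<mapsto> F + s (v + o(1))\<close>, where \<open>v\<close> is a real vector all of whose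
entries are positive and \<open>s\<close> runs through a neighbourhood of \<open>0\<close> in the field. Imaginary \<open>s = \<i> t\<close>
gives complex solutions with positive imaginary parts. The pseudo-complex numbers are the ring
\<open>\<real> \<times> \<real>\<close> in the null coordinates \<open>a + b\<close>, \<open>a - b\<close> of \<open>a + b \<tau>\<close>, so a pair of real solutions
is a pseudo-complex one; the pair \<open>s = t\<close>, \<open>s = - t\<close> has positive imaginary parts because \<open>v\<close> is
positive. Both families converge to \<open>F\<close> as \<open>t \<rightarrow> 0\<close>.

The positive vector \<open>v\<close> comes from a sign pattern. For real \<open>z > 0\<close> the parameter \<open>z\<close> is positive
and exactly one of \<open>x\<close>, \<open>y\<close> is negative; moreover each of the three is negative exactly when its
logarithmic derivative with respect to \<open>z\<close> is negative. Each of \<open>x\<close> and \<open>y\<close> belongs to two opposite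
corners (dihedral angles) of its tetrahedron, and these two are glued to the same edge of the
triangulation. An edge has exactly two
negative factors, so every edge sees the negative corners of exactly one tetrahedron, and this is a
bijection between tetrahedra and edges (\<open>bij_negative_edge\<close>). Hence the Jacobian of the
logarithmic edge holonomies, its rows rearranged by this bijection, is nonnegative off the diagonal.
Its columns sum to zero since the six corners of a tetrahedron multiply to \<open>(x y z)\<^sup>2 = 1\<close>. Finally
the edge that sees a corner \<open>x\<close> or \<open>y\<close> of a tetrahedron also meets the preceding tetrahedron in
the cyclic order (\<open>corner_edge_meets_prev\<close>), which makes the matrix irreducible. By the
Perron-Frobenius argument in \<open>kernel_spanned_by_positive_vector\<close> its kernel is a line spanned by
a positive vector.

So the Jacobian has corank one, and the equations have exactly one redundancy, as the product of all
edge holonomies is identically \<open>1\<close>. The curve of solutions therefore exists by the implicit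
function theorem, which \<open>redundant_system_solution_curve\<close> proves in the form used here by a
contraction depending on \<open>s\<close>. The angle conditions persist along the curve: logarithms of the
factors are continued from \<open>F\<close>, where the two negative factors of each edge contribute \<open>\<pi>\<close> each,
and the continuations add up to zero (\<open>Arg_shape\<close>).\<close>

section \<open>Matrices with zero column sums and one negative entry in each column\<close>

text \<open>Gaussian elimination: an equation with a nonzero coefficient eliminates one unknown, and an
  equation without one can be dropped.\<close>

lemma underdetermined_system_has_nonzero_solution:
  fixes A :: "'q \<Rightarrow> 'i \<Rightarrow> 'a::field"
  assumes "finite Q" "finite I" "card Q < card I"
  shows "\<exists>x. (\<exists>i\<in>I. x i \<noteq> 0) \<and> (\<forall>q\<in>Q. (\<Sum>i\<in>I. A q i * x i) = 0)"
  using assms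
proof (induction Q arbitrary: A I rule: finite_induct)
  case empty
  then show ?case
    by (intro exI[of _ "\<lambda>_. 1"]) (auto simp: card_gt_0_iff)
next
  case (insert p Q A I)
  show ?case
  proof (cases "\<forall>i\<in>I. A p i = 0")
    case True
    have "card Q < card I" using insert by simp
    from insert.IH[OF insert.prems(1) this, of A] True show ?thesis
      by auto
  next
    case False
    then obtain k where k: "k \<in> I" "A p k \<noteq> 0" by blast
    define J where "J = I - {k}"
    have J: "finite J" "k \<notin> J" "I = insert k J"
      using k insert.prems by (auto simp: J_def)
    have "card Q < card J"
      using insert J by simp
    from insert.IH[OF J(1) this, of "\<lambda>q i. A q i - A q k * A p i / A p k"]
    obtain x where x: "\<exists>i\<in>J. x i \<noteq> 0"
      "\<And>q. q \<in> Q \<Longrightarrow> (\<Sum>i\<in>J. (A q i - A q k * A p i / A p k) * x i) = 0"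
      by blast
    define y where "y = x(k := - (\<Sum>i\<in>J. A p i * x i) / A p k)"
    have sum_y: "(\<Sum>i\<in>I. A q i * y i) = (\<Sum>i\<in>J. A q i * x i) - A q k / A p k * (\<Sum>i\<in>J. A p i * x i)" for q
    proof -
      have "(\<Sum>i\<in>J. A q i * y i) = (\<Sum>i\<in>J. A q i * x i)"
        using J(2) by (intro sum.cong) (auto simp: y_def)
      then show ?thesis
        using J by (simp add: y_def)
    qed
    have "(\<Sum>i\<in>I. A q i * y i) = 0" if "q \<in> Q" for q
    proof -
      have "(\<Sum>i\<in>J. A q i * x i) - A q k / A p k * (\<Sum>i\<in>J. A p i * x i)
          = (\<Sum>i\<in>J. (A q i - A q k * A p i / A p k) * x i)"
        by (simp add: sum_distrib_left sum_subtractf[symmetric] algebra_simps)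
      then show ?thesis
        using x(2)[OF that] by (simp add: sum_y)
    qed
    moreover have "(\<Sum>i\<in>I. A p i * y i) = 0"
      using k(2) by (simp add: sum_y)
    moreover have "\<exists>i\<in>I. y i \<noteq> 0"
      using x(1) J by (force simp: y_def)
    ultimately show ?thesis
      by (intro exI[of _ y]) auto
  qed
qed

text \<open>The \<open>k\<close>-th column of the inverse is found by adjoining an unknown \<open>x\<^sub>n\<close> that scales the \<open>k\<close>-th
  unit vector on the right-hand side. The enlarged homogeneous system has a nonzero solution, and
  injectivity forces \<open>x\<^sub>n \<noteq> 0\<close>, so the solution can be normalised to \<open>x\<^sub>n = 1\<close>.\<close>

lemma injective_square_system_right_inverse:
  fixes A :: "nat \<Rightarrow> nat \<Rightarrow> 'a::field"
  assumes "\<And>x. (\<And>q. q < n \<Longrightarrow> (\<Sum>i<n. A q i * x i) = 0) \<Longrightarrow> (\<And>i. i < n \<Longrightarrow> x i = 0)"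
  shows "\<exists>B. \<forall>q<n. \<forall>k<n. (\<Sum>i<n. A q i * B i k) = (if q = k then 1 else 0)"
proof -
  have "\<exists>b. \<forall>q<n. (\<Sum>i<n. A q i * b i) = (if q = k then 1 else 0)" if "k < n" for k
  proof -
    obtain x where x: "\<exists>i\<le>n. x i \<noteq> 0"
      "\<And>q. q < n \<Longrightarrow> (\<Sum>i\<le>n. (if i = n then - (if q = k then 1 else 0) else A q i) * x i) = 0"
      using underdetermined_system_has_nonzero_solution[of "{..<n}" "{..n}"
          "\<lambda>q i. if i = n then - (if q = k then 1 else 0) else A q i"]
      by auto
    have eq: "(\<Sum>i<n. A q i * x i) = (if q = k then x n else 0)" if "q < n" for q
    proof -
      have "(\<Sum>i<n. (if i = n then - (if q = k then 1 else 0) else A q i) * x i) = (\<Sum>i<n. A q i * x i)"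
        by (intro sum.cong) auto
      then show ?thesis
        using x(2)[OF that] by (auto simp: lessThan_Suc_atMost[symmetric] split: if_splits)
    qed
    have "x n \<noteq> 0"
    proof
      assume "x n = 0"
      then have "x i = 0" if "i < n" for i
        using assms[of x] eq that by (metis (no_types, lifting))
      with \<open>x n = 0\<close> x(1) show False
        using le_neq_implies_less by blast
    qed
    then have "\<forall>q<n. (\<Sum>i<n. A q i * (x i / x n)) = (if q = k then 1 else 0)"
      using eq by (simp add: sum_divide_distrib[symmetric])
    then show ?thesis by (intro exI[of _ "\<lambda>i. x i / x n"])
  qed
  then have "\<forall>k. \<exists>b. k < n \<longrightarrow> (\<forall>q<n. (\<Sum>i<n. A q i * b i) = (if q = k then 1 else 0))"
    by blast
  then obtain b where "\<forall>k. k < n \<longrightarrow> (\<forall>q<n. (\<Sum>i<n. A q i * b k i) = (if q = k then 1 else 0))"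
    by metis
  then show ?thesis
    by (intro exI[of _ "\<lambda>i k. b k i"]) auto
qed

lemma cyclic_predecessor_induct:
  fixes n :: nat
  assumes "c < n" "P c" "\<And>i. i < n \<Longrightarrow> P i \<Longrightarrow> P ((i + n - 1) mod n)" "i < n"
  shows "P i"
proof -
  have down: "P (m - d)" if "d \<le> m" "m < n" "P m" for m d
    using that
  proof (induction d)
    case (Suc d)
    then have "P (m - d)" "m - d < n" "0 < m - d" by auto
    moreover from this have "(m - d + n - 1) mod n = m - d - 1"
      by (simp add: mod_if)
    ultimately show ?case using assms(3)[of "m - d"] by (metis diff_Suc_eq_diff_pred diff_commute)
  qed auto
  have "P 0" using down[of c c] assms by simp
  then have "P (n - 1)" using assms(3)[of 0] assms(1) by simp
  then show ?thesis using down[of "n - 1 - i" "n - 1"] assms(4) by simp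
qed

lemma sum_of_rows_zero:
  fixes M :: "nat \<Rightarrow> nat \<Rightarrow> real" and x :: "nat \<Rightarrow> 'a::real_vector"
  assumes "\<And>i. i < n \<Longrightarrow> (\<Sum>q<n. M q i) = 0"
  shows "(\<Sum>q<n. \<Sum>i<n. M q i *\<^sub>R x i) = 0"
proof -
  have "(\<Sum>q<n. \<Sum>i<n. M q i *\<^sub>R x i) = (\<Sum>i<n. (\<Sum>q<n. M q i) *\<^sub>R x i)"
    by (subst sum.swap) (simp add: scaleR_sum_left)
  then show ?thesis by (simp add: assms)
qed

text \<open>Such a matrix is the transposed generator of a Markov chain. Every state is linked to its cyclic
  predecessor, so the chain is irreducible and its stationary measure, the kernel vector, is positive
  and unique up to scaling.\<close>

context
  fixes n :: nat and A :: "nat \<Rightarrow> nat \<Rightarrow> real"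
  assumes off_diagonal: "\<And>q i. q < n \<Longrightarrow> i < n \<Longrightarrow> q \<noteq> i \<Longrightarrow> 0 \<le> A q i"
    and column_sums: "\<And>i. i < n \<Longrightarrow> (\<Sum>q<n. A q i) = 0"
    and predecessor: "\<And>q. q < n \<Longrightarrow> 0 < A q ((q + n - 1) mod n)"
    and two: "2 \<le> n"
begin

text \<open>With \<open>A x = 0\<close> the triangle inequality gives \<open>A \<bar>x\<bar> \<ge> 0\<close>, because only the diagonal entries are
  negative. The entries of \<open>A \<bar>x\<bar>\<close> add up to zero by the vanishing column sums, so all of them
  vanish.\<close>

lemma kernel_abs:
  assumes x: "\<And>q. q < n \<Longrightarrow> (\<Sum>i<n. A q i * x i) = 0" and "q < n"
  shows "(\<Sum>i<n. A q i * \<bar>x i\<bar>) = 0"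
proof -
  have nonneg: "0 \<le> (\<Sum>i<n. A q i * \<bar>x i\<bar>)" if "q < n" for q
  proof -
    have split: "(\<Sum>i<n. A q i * f i) = A q q * f q + (\<Sum>i\<in>{..<n}-{q}. A q i * f i)" for f :: "nat \<Rightarrow> real"
      using that by (simp add: sum.remove)
    have "A q q + (\<Sum>p\<in>{..<n}-{q}. A p q) = 0"
      using column_sums[OF that] that by (simp add: sum.remove)
    moreover have "0 \<le> (\<Sum>p\<in>{..<n}-{q}. A p q)"
      using that off_diagonal by (intro sum_nonneg) auto
    ultimately have diag: "A q q \<le> 0" by linarith
    have "- (A q q * \<bar>x q\<bar>) = \<bar>A q q * x q\<bar>"
      using diag by (simp add: abs_mult)
    also have "\<dots> = \<bar>\<Sum>i\<in>{..<n}-{q}. A q i * x i\<bar>"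
      using x[OF that] split[of x] by linarith
    also have "\<dots> \<le> (\<Sum>i\<in>{..<n}-{q}. \<bar>A q i * x i\<bar>)"
      by (rule sum_abs)
    also have "\<dots> = (\<Sum>i\<in>{..<n}-{q}. A q i * \<bar>x i\<bar>)"
      using that off_diagonal by (intro sum.cong) (auto simp: abs_mult)
    finally show ?thesis using split[of "\<lambda>i. \<bar>x i\<bar>"] by linarith
  qed
  have total: "(\<Sum>q<n. \<Sum>i<n. A q i * \<bar>x i\<bar>) = 0"
    using sum_of_rows_zero[of n A "\<lambda>i. \<bar>x i\<bar>"] column_sums by simp
  have "\<forall>q\<in>{..<n}. (\<Sum>i<n. A q i * \<bar>x i\<bar>) = 0"
    using total nonneg
    by (subst (asm) sum_nonneg_eq_0_iff) auto
  then show ?thesis using assms(2) by blast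
qed

text \<open>In row \<open>q\<close> all terms are nonnegative once \<open>x\<^sub>q = 0\<close>, so each of them vanishes; the positive entry
  in the column of the predecessor of \<open>q\<close> carries the zero on around the cycle.\<close>

lemma kernel_nonneg_with_zero:
  assumes x: "\<And>q. q < n \<Longrightarrow> (\<Sum>i<n. A q i * x i) = 0"
    and nonneg: "\<And>i. i < n \<Longrightarrow> 0 \<le> x i" and c: "c < n" "x c = 0" and "i < n"
  shows "x i = 0"
proof (rule cyclic_predecessor_induct[of c n "\<lambda>i. x i = 0", OF c _ \<open>i < n\<close>])
  fix q assume q: "q < n" "x q = 0"
  have "\<forall>i\<in>{..<n}. A q i * x i = 0"
  proof (subst sum_nonneg_eq_0_iff[symmetric])
    show "0 \<le> A q i * x i" if "i \<in> {..<n}" for i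
      using that q off_diagonal[of q i] nonneg[of i] by (cases "i = q") auto
  qed (use x[OF q(1)] in auto)
  then show "x ((q + n - 1) mod n) = 0"
    using predecessor[OF q(1)] q(1) by (metis lessThan_iff less_numeral_extra(3) mod_less_divisor mult_eq_0_iff not_gr_zero not_less0)
qed

text \<open>Redundancy of the rows yields a kernel vector, and its absolute value is a positive one. Any
  other kernel vector minus its smallest ratio to \<open>v\<close> times \<open>v\<close> is nonnegative and has a zero
  entry, hence vanishes.\<close>

lemma kernel_spanned_by_positive_vector:
  obtains v where "\<And>i. i < n \<Longrightarrow> 0 < v i" "\<And>q. q < n \<Longrightarrow> (\<Sum>i<n. A q i * v i) = 0"
    "\<And>u. (\<And>q. q < n \<Longrightarrow> (\<Sum>i<n. A q i * u i) = 0) \<Longrightarrow> \<exists>t. \<forall>i<n. u i = t * v i"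
proof -
  obtain x where x: "\<exists>i<n. x i \<noteq> 0" "\<And>q. q \<in> {..<n} - {0} \<Longrightarrow> (\<Sum>i<n. A q i * x i) = 0"
    using underdetermined_system_has_nonzero_solution[of "{..<n} - {0}" "{..<n}" A] two
    by (auto simp: card_Diff_singleton)
  have x_ker: "(\<Sum>i<n. A q i * x i) = 0" if "q < n" for q
  proof (cases "q = 0")
    case True
    have "(\<Sum>q<n. \<Sum>i<n. A q i * x i) = (\<Sum>i<n. A 0 i * x i) + (\<Sum>q\<in>{..<n} - {0}. \<Sum>i<n. A q i * x i)"
      using two by (intro sum.remove) auto
    then show ?thesis using x(2) sum_of_rows_zero[of n A x] column_sums True by simp
  qed (use x that in auto)
  define v where "v i = \<bar>x i\<bar>" for i
  have v_ker: "(\<Sum>i<n. A q i * v i) = 0" if "q < n" for q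
    unfolding v_def by (rule kernel_abs[OF x_ker that])
  have v_pos: "0 < v i" if "i < n" for i
    using kernel_nonneg_with_zero[of v, OF v_ker _ that] x(1) unfolding v_def
    by (metis abs_ge_zero abs_eq_0 zero_less_abs_iff)
  have "\<exists>t. \<forall>i<n. u i = t * v i" if u: "\<And>q. q < n \<Longrightarrow> (\<Sum>i<n. A q i * u i) = 0" for u
  proof -
    define t where "t = Min ((\<lambda>i. u i / v i) ` {..<n})"
    have ne: "(\<lambda>i. u i / v i) ` {..<n} \<noteq> {}" using two by (auto simp: lessThan_empty_iff)
    obtain c where c: "c < n" "t = u c / v c"
      using Min_in[OF _ ne] by (auto simp: t_def)
    have le: "t * v i \<le> u i" if "i < n" for i
    proof -
      have "t \<le> u i / v i" using that by (auto simp: t_def intro!: Min_le)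
      then show ?thesis using v_pos[OF that] by (simp add: pos_le_divide_eq)
    qed
    have "u i - t * v i = 0" if "i < n" for i
    proof (rule kernel_nonneg_with_zero[of "\<lambda>i. u i - t * v i" c, OF _ _ c(1) _ that])
      show "(\<Sum>i<n. A q i * (u i - t * v i)) = 0" if "q < n" for q
      proof -
        have "(\<Sum>i<n. A q i * (u i - t * v i)) = (\<Sum>i<n. A q i * u i) - t * (\<Sum>i<n. A q i * v i)"
          by (simp add: right_diff_distrib sum_subtractf sum_distrib_left mult.left_commute)
        then show ?thesis using u[OF that] v_ker[OF that] by simp
      qed
      show "u c - t * v c = 0" using c v_pos[OF c(1)] by simp
    qed (use le in auto)
    then show ?thesis by (intro exI[of _ t]) auto
  qed
  then show ?thesis using that v_pos v_ker by blast
qed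

end

section \<open>Solving a redundant system along the kernel of its linear part\<close>

text \<open>The fixed point moves by at most \<open>1 / (1 - \<kappa>)\<close> times the distance by which the contraction moves
  the old fixed point.\<close>

lemma contraction_fixed_point_continuous:
  fixes T :: "'p::topological_space \<Rightarrow> 'e::metric_space \<Rightarrow> 'e"
  assumes "complete C" "C \<noteq> {}" "0 \<le> \<kappa>" "\<kappa> < 1"
    and self: "\<And>s u. s \<in> S \<Longrightarrow> u \<in> C \<Longrightarrow> T s u \<in> C"
    and contr: "\<And>s u u'. s \<in> S \<Longrightarrow> u \<in> C \<Longrightarrow> u' \<in> C \<Longrightarrow> dist (T s u) (T s u') \<le> \<kappa> * dist u u'"
    and cont: "\<And>u. u \<in> C \<Longrightarrow> continuous_on S (\<lambda>s. T s u)"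
  obtains U where "continuous_on S U" "\<And>s. s \<in> S \<Longrightarrow> U s \<in> C" "\<And>s. s \<in> S \<Longrightarrow> T s (U s) = U s"
proof -
  have "\<exists>u\<in>C. T s u = u" if "s \<in> S" for s
    using Banach_fix[OF assms(1-4), of "T s"] self[OF that] contr[OF that] by blast
  then obtain U where U: "\<And>s. s \<in> S \<Longrightarrow> U s \<in> C" "\<And>s. s \<in> S \<Longrightarrow> T s (U s) = U s"
    by metis
  have "continuous_on S U"
    unfolding continuous_on_def
  proof
    fix p assume p: "p \<in> S"
    have bound: "dist (U s) (U p) \<le> dist (T s (U p)) (T p (U p)) / (1 - \<kappa>)" if "s \<in> S" for s
    proof -
      have "dist (U s) (U p) \<le> dist (T s (U s)) (T s (U p)) + dist (T s (U p)) (T p (U p))"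
        using dist_triangle[of "T s (U s)" "T p (U p)" "T s (U p)"] U p that by simp
      also have "dist (T s (U s)) (T s (U p)) \<le> \<kappa> * dist (U s) (U p)"
        by (rule contr[OF that U(1)[OF that] U(1)[OF p]])
      finally show ?thesis using \<open>\<kappa> < 1\<close> by (simp add: pos_le_divide_eq algebra_simps)
    qed
    have "((\<lambda>s. T s (U p)) \<longlongrightarrow> T p (U p)) (at p within S)"
      using cont[OF U(1)[OF p]] p by (simp add: continuous_on_def)
    then have "((\<lambda>s. dist (T s (U p)) (T p (U p)) / (1 - \<kappa>)) \<longlongrightarrow> 0 / (1 - \<kappa>)) (at p within S)"
      using \<open>\<kappa> < 1\<close> by (intro tendsto_divide tendsto_const) (auto simp: tendsto_dist_iff[symmetric])
    then have "((\<lambda>s. dist (U s) (U p)) \<longlongrightarrow> 0) (at p within S)"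
    proof (intro Lim_null_comparison[of "\<lambda>s. dist (U s) (U p)" "\<lambda>s. dist (T s (U p)) (T p (U p)) / (1 - \<kappa>)"])
      show "\<forall>\<^sub>F s in at p within S. norm (dist (U s) (U p)) \<le> dist (T s (U p)) (T p (U p)) / (1 - \<kappa>)"
        using bound by (auto simp: eventually_at_filter)
    qed simp
    then show "(U \<longlongrightarrow> U p) (at p within S)"
      by (subst tendsto_dist_iff)
  qed
  then show ?thesis using that U by blast
qed

text \<open>A Cauchy sequence converges uniformly, whatever the topology of the domain; this covers bounded
  functions on \<^typ>\<open>nat\<close>.\<close>

lemma complete_bounded_continuous_functions:
  "complete (UNIV :: ('a::topological_space \<Rightarrow>\<^sub>C 'b::complete_space) set)"
proof (rule completeI)
  fix f :: "nat \<Rightarrow> 'a \<Rightarrow>\<^sub>C 'b"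
  assume "Cauchy f"
  then obtain g where "uniform_limit UNIV (\<lambda>k. apply_bcontfun (f k)) g sequentially"
    using uniformly_convergent_eq_cauchy[of "\<lambda>_. True" "\<lambda>k. apply_bcontfun (f k)"]
    unfolding Cauchy_def uniform_limit_sequentially_iff
    by (metis dist_fun_lt_imp_dist_val_lt)
  from uniform_limit_bcontfunE[OF this sequentially_bot]
  obtain l where "f \<longlonglongrightarrow> l" .
  then show "\<exists>l\<in>UNIV. f \<longlonglongrightarrow> l" by (rule bexI) simp
qed

text \<open>Vectors with \<open>n\<close> entries, with \<open>n\<close> a term, are realised as the sequences vanishing from
  \<open>n\<close> onwards, inside the Banach space of bounded sequences with the supremum norm.\<close>

definition truncate :: "nat \<Rightarrow> (nat \<Rightarrow> 'a) \<Rightarrow> (nat \<Rightarrow>\<^sub>C 'a::real_normed_vector)" where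
  "truncate n f = Bcontfun (\<lambda>i. if i < n then f i else 0)"

lemma apply_truncate: "apply_bcontfun (truncate n f) i = (if i < n then f i else 0)"
proof -
  have "(\<lambda>i. if i < n then f i else 0) \<in> bcontfun"
  proof (rule bcontfun_normI)
    show "norm (if i < n then f i else 0) \<le> (\<Sum>j<n. norm (f j))" for i
      by (auto intro!: member_le_sum[of _ _ "\<lambda>j. norm (f j)"] sum_nonneg)
  qed simp
  then show ?thesis by (simp add: truncate_def Bcontfun_inverse)
qed

lemma dist_truncate_le:
  assumes "\<And>i. i < n \<Longrightarrow> norm (f i - g i) \<le> B" "0 \<le> B"
  shows "dist (truncate n f) (truncate n g) \<le> B"
  unfolding dist_norm by (rule norm_bound) (use assms in \<open>simp add: apply_truncate\<close>)

lemma truncate_zero: "truncate n (\<lambda>_. 0) = 0"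
  by (rule bcontfun_eqI) (simp add: apply_truncate)

lemma continuous_on_truncate:
  fixes f :: "'p::topological_space \<Rightarrow> nat \<Rightarrow> 'a::real_normed_vector"
  assumes "\<And>i. i < n \<Longrightarrow> continuous_on S (\<lambda>s. f s i)"
  shows "continuous_on S (\<lambda>s. truncate n (f s))"
  unfolding continuous_on_def
proof
  fix p assume p: "p \<in> S"
  have "((\<lambda>s. \<Sum>i<n. norm (f s i - f p i)) \<longlongrightarrow> (\<Sum>i<n. norm (f p i - f p i))) (at p within S)"
    using assms p by (intro tendsto_sum tendsto_norm tendsto_diff tendsto_const)
      (auto simp: continuous_on_def)
  then have "((\<lambda>s. dist (truncate n (f s)) (truncate n (f p))) \<longlongrightarrow> 0) (at p within S)"
  proof (intro Lim_null_comparison[of "\<lambda>s. dist (truncate n (f s)) (truncate n (f p))" "\<lambda>s. \<Sum>i<n. norm (f s i - f p i)"])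
    show "\<forall>\<^sub>F s in at p within S. norm (dist (truncate n (f s)) (truncate n (f p))) \<le> (\<Sum>i<n. norm (f s i - f p i))"
      unfolding real_norm_def abs_of_nonneg[OF zero_le_dist]
      by (intro always_eventually allI dist_truncate_le sum_nonneg)
        (auto intro!: member_le_sum[of _ _ "\<lambda>i. norm (f _ i - f p i)"])
  qed simp
  then show "((\<lambda>s. truncate n (f s)) \<longlongrightarrow> truncate n (f p)) (at p within S)"
    by (subst tendsto_dist_iff)
qed

text \<open>Strict differentiability at the origin with derivative zero: near the origin, the Lipschitz
  constant for the maximum norm on the first \<open>n\<close> coordinates can be made arbitrarily small.\<close>

definition flat_at_zero :: "nat \<Rightarrow> ((nat \<Rightarrow> 'k) \<Rightarrow> 'k::real_normed_vector) \<Rightarrow> bool" where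
  "flat_at_zero n g \<longleftrightarrow> g (\<lambda>_. 0) = 0 \<and>
     (\<forall>\<epsilon>>0. \<exists>\<delta>>0. \<forall>x y B. (\<forall>i<n. norm (x i) \<le> \<delta> \<and> norm (y i) \<le> \<delta> \<and> norm (x i - y i) \<le> B)
        \<longrightarrow> norm (g x - g y) \<le> \<epsilon> * B)"

lemma flat_at_zeroD:
  assumes "flat_at_zero n g" "0 < \<epsilon>"
  obtains \<delta> where "0 < \<delta>"
    "\<And>x y B. (\<And>i. i < n \<Longrightarrow> norm (x i) \<le> \<delta>) \<Longrightarrow> (\<And>i. i < n \<Longrightarrow> norm (y i) \<le> \<delta>) \<Longrightarrow>
      (\<And>i. i < n \<Longrightarrow> norm (x i - y i) \<le> B) \<Longrightarrow> norm (g x - g y) \<le> \<epsilon> * B"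
proof -
  from assms obtain \<delta> where "0 < \<delta>"
    "\<forall>x y B. (\<forall>i<n. norm (x i) \<le> \<delta> \<and> norm (y i) \<le> \<delta> \<and> norm (x i - y i) \<le> B)
        \<longrightarrow> norm (g x - g y) \<le> \<epsilon> * B"
    unfolding flat_at_zero_def by blast
  then show ?thesis by (intro that[of \<delta>]) auto
qed

lemma flat_at_zero_uniform:
  fixes G :: "nat \<Rightarrow> (nat \<Rightarrow> 'k) \<Rightarrow> 'k::real_normed_vector"
  assumes flat: "\<And>q. q < n \<Longrightarrow> flat_at_zero n (G q)" and "0 < \<epsilon>" "0 < n"
  obtains \<delta> where "0 < \<delta>"
    "\<And>x y B q. (\<And>i. i < n \<Longrightarrow> norm (x i) \<le> \<delta>) \<Longrightarrow> (\<And>i. i < n \<Longrightarrow> norm (y i) \<le> \<delta>) \<Longrightarrow>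
      (\<And>i. i < n \<Longrightarrow> norm (x i - y i) \<le> B) \<Longrightarrow> q < n \<Longrightarrow> norm (G q x - G q y) \<le> \<epsilon> * B"
proof -
  have "\<forall>q. \<exists>\<delta>>0. q < n \<longrightarrow> (\<forall>x y B. (\<forall>i<n. norm (x i) \<le> \<delta> \<and> norm (y i) \<le> \<delta> \<and> norm (x i - y i) \<le> B)
        \<longrightarrow> norm (G q x - G q y) \<le> \<epsilon> * B)"
    using flat \<open>0 < \<epsilon>\<close> unfolding flat_at_zero_def by (metis zero_less_one)
  then obtain \<delta> where \<delta>: "\<And>q. 0 < \<delta> q" "\<And>q. q < n \<Longrightarrow> (\<forall>x y B. (\<forall>i<n. norm (x i) \<le> \<delta> q \<and> norm (y i) \<le> \<delta> q \<and> norm (x i - y i) \<le> B)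
        \<longrightarrow> norm (G q x - G q y) \<le> \<epsilon> * B)"
    by metis
  define \<delta>' where "\<delta>' = Min (\<delta> ` {..<n})"
  have \<delta>': "0 < \<delta>'" "\<And>q. q < n \<Longrightarrow> \<delta>' \<le> \<delta> q"
    using \<delta>(1) \<open>0 < n\<close> by (auto simp: \<delta>'_def Min_gr_iff lessThan_empty_iff)
  show ?thesis
  proof (rule that[OF \<delta>'(1)])
    fix x y :: "nat \<Rightarrow> 'k" and B q
    assume "\<And>i. i < n \<Longrightarrow> norm (x i) \<le> \<delta>'" "\<And>i. i < n \<Longrightarrow> norm (y i) \<le> \<delta>'"
      "\<And>i. i < n \<Longrightarrow> norm (x i - y i) \<le> B" "q < n"
    then have "\<forall>i<n. norm (x i) \<le> \<delta> q \<and> norm (y i) \<le> \<delta> q \<and> norm (x i - y i) \<le> B"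
      using \<delta>'(2)[of q] order_trans by blast
    then show "norm (G q x - G q y) \<le> \<epsilon> * B" using \<delta>(2)[OF \<open>q < n\<close>] by blast
  qed
qed

lemma flat_at_zero_zero:
  assumes "0 < n"
  shows "flat_at_zero n (\<lambda>_. 0 :: 'a::real_normed_vector)"
  unfolding flat_at_zero_def
proof (intro conjI allI impI exI[of _ 1])
  fix \<epsilon> :: real and x y :: "nat \<Rightarrow> 'a" and B :: real
  assume "0 < \<epsilon>" "\<forall>i<n. norm (x i) \<le> 1 \<and> norm (y i) \<le> 1 \<and> norm (x i - y i) \<le> B"
  then have "0 \<le> B" using assms norm_ge_zero order_trans by blast
  then show "norm (0 - 0 :: 'a) \<le> \<epsilon> * B" using \<open>0 < \<epsilon>\<close> by simp
qed auto

lemma flat_at_zero_uminus: "flat_at_zero n g \<Longrightarrow> flat_at_zero n (\<lambda>x. - g x)"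
  by (simp add: flat_at_zero_def norm_minus_commute)

lemma flat_at_zero_add:
  fixes g h :: "(nat \<Rightarrow> 'k) \<Rightarrow> 'k::real_normed_vector"
  assumes "flat_at_zero n g" "flat_at_zero n h"
  shows "flat_at_zero n (\<lambda>x. g x + h x)"
  unfolding flat_at_zero_def
proof (intro conjI allI impI)
  show "g (\<lambda>_. 0) + h (\<lambda>_. 0) = 0" using assms by (simp add: flat_at_zero_def)
  fix \<epsilon> :: real assume "0 < \<epsilon>"
  then have half: "0 < \<epsilon> / 2" by simp
  from flat_at_zeroD[OF assms(1) half] obtain \<delta>\<^sub>1 where \<delta>\<^sub>1: "0 < \<delta>\<^sub>1"
    "\<And>x y B. (\<And>i. i < n \<Longrightarrow> norm (x i) \<le> \<delta>\<^sub>1) \<Longrightarrow> (\<And>i. i < n \<Longrightarrow> norm (y i) \<le> \<delta>\<^sub>1) \<Longrightarrow>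
      (\<And>i. i < n \<Longrightarrow> norm (x i - y i) \<le> B) \<Longrightarrow> norm (g x - g y) \<le> \<epsilon> / 2 * B" by blast
  from flat_at_zeroD[OF assms(2) half] obtain \<delta>\<^sub>2 where \<delta>\<^sub>2: "0 < \<delta>\<^sub>2"
    "\<And>x y B. (\<And>i. i < n \<Longrightarrow> norm (x i) \<le> \<delta>\<^sub>2) \<Longrightarrow> (\<And>i. i < n \<Longrightarrow> norm (y i) \<le> \<delta>\<^sub>2) \<Longrightarrow>
      (\<And>i. i < n \<Longrightarrow> norm (x i - y i) \<le> B) \<Longrightarrow> norm (h x - h y) \<le> \<epsilon> / 2 * B" by blast
  show "\<exists>\<delta>>0. \<forall>x y B. (\<forall>i<n. norm (x i) \<le> \<delta> \<and> norm (y i) \<le> \<delta> \<and> norm (x i - y i) \<le> B)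
      \<longrightarrow> norm (g x + h x - (g y + h y)) \<le> \<epsilon> * B"
  proof (intro exI[of _ "min \<delta>\<^sub>1 \<delta>\<^sub>2"] conjI allI impI)
    fix x y :: "nat \<Rightarrow> 'k" and B
    assume "\<forall>i<n. norm (x i) \<le> min \<delta>\<^sub>1 \<delta>\<^sub>2 \<and> norm (y i) \<le> min \<delta>\<^sub>1 \<delta>\<^sub>2 \<and> norm (x i - y i) \<le> B"
    then have xy: "norm (x i) \<le> min \<delta>\<^sub>1 \<delta>\<^sub>2" "norm (y i) \<le> min \<delta>\<^sub>1 \<delta>\<^sub>2"
        "norm (x i - y i) \<le> B" if "i < n" for i
      using that by blast+
    have "norm (g x - g y) \<le> \<epsilon> / 2 * B"
      by (rule \<delta>\<^sub>1(2)) (use xy in auto)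
    moreover have "norm (h x - h y) \<le> \<epsilon> / 2 * B"
      by (rule \<delta>\<^sub>2(2)) (use xy in auto)
    ultimately show "norm (g x + h x - (g y + h y)) \<le> \<epsilon> * B"
      using norm_triangle_ineq[of "g x - g y" "h x - h y"] by (simp add: algebra_simps)
  qed (use \<delta>\<^sub>1 \<delta>\<^sub>2 in auto)
qed

lemma flat_at_zero_coordinate:
  fixes \<rho> :: "'k::real_normed_field \<Rightarrow> 'k"
  assumes "\<rho> 0 = 0" and "i < n"
    and "\<And>\<epsilon>. 0 < \<epsilon> \<Longrightarrow> \<exists>\<delta>>0. \<forall>x y. norm x \<le> \<delta> \<longrightarrow> norm y \<le> \<delta> \<longrightarrow> norm (\<rho> x - \<rho> y) \<le> \<epsilon> * norm (x - y)"
  shows "flat_at_zero n (\<lambda>x. \<rho> (c * x i))"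
  unfolding flat_at_zero_def
proof (intro conjI allI impI)
  fix \<epsilon> :: real assume \<epsilon>: "0 < \<epsilon>"
  define C where "C = norm c + 1"
  have C: "0 < C" "norm c \<le> C" by (auto simp: C_def add_nonneg_pos)
  obtain \<delta> where \<delta>: "0 < \<delta>" "\<And>x y. norm x \<le> \<delta> \<Longrightarrow> norm y \<le> \<delta> \<Longrightarrow> norm (\<rho> x - \<rho> y) \<le> \<epsilon> / C * norm (x - y)"
    using assms(3)[of "\<epsilon> / C"] \<epsilon> C(1) by auto
  have scale: "norm (c * a) \<le> C * b" if "norm a \<le> b" for a b
    using that C norm_ge_zero[of a] by (simp add: norm_mult mult_mono)
  show "\<exists>\<delta>>0. \<forall>x y B. (\<forall>j<n. norm (x j) \<le> \<delta> \<and> norm (y j) \<le> \<delta> \<and> norm (x j - y j) \<le> B)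
      \<longrightarrow> norm (\<rho> (c * x i) - \<rho> (c * y i)) \<le> \<epsilon> * B"
  proof (intro exI[of _ "\<delta> / C"] conjI allI impI)
    fix x y :: "nat \<Rightarrow> 'k" and B
    assume "\<forall>j<n. norm (x j) \<le> \<delta> / C \<and> norm (y j) \<le> \<delta> / C \<and> norm (x j - y j) \<le> B"
    then have xy: "norm (x i) \<le> \<delta> / C" "norm (y i) \<le> \<delta> / C" "norm (x i - y i) \<le> B"
      using \<open>i < n\<close> by auto
    have "norm (\<rho> (c * x i) - \<rho> (c * y i)) \<le> \<epsilon> / C * norm (c * x i - c * y i)"
      using scale[OF xy(1)] scale[OF xy(2)] C(1) by (intro \<delta>(2)) auto
    also have "\<dots> \<le> \<epsilon> / C * (C * B)"
      using scale[OF xy(3)] \<epsilon> C(1) by (intro mult_left_mono) (auto simp: right_diff_distrib)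
    finally show "norm (\<rho> (c * x i) - \<rho> (c * y i)) \<le> \<epsilon> * B" using C(1) by simp
  qed (use \<delta> C in auto)
qed (use assms in simp)

text \<open>The convention \<^term>\<open>inverse 0 = 0\<close> spares the case distinction at \<open>s = 0\<close>.\<close>

lemma norm_inverse_mult_le:
  fixes s g :: "'k::real_normed_field"
  assumes "norm g \<le> e * (norm s * b)" "0 \<le> e * b"
  shows "norm (inverse s * g) \<le> e * b"
proof (cases "s = 0")
  case False
  have "norm (inverse s * g) \<le> inverse (norm s) * (e * (norm s * b))"
    unfolding norm_mult norm_inverse using assms(1) by (rule mult_left_mono) simp
  also have "\<dots> = e * b" using False by simp
  finally show ?thesis .
qed (use assms in simp)

text \<open>The blow-up \<open>g (s a) / s\<close> extends continuously to \<open>s = 0\<close> by \<open>0\<close>, which is also its value there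
  under the convention \<^term>\<open>inverse 0 = 0\<close>.\<close>

lemma flat_rescaling_continuous:
  fixes g :: "(nat \<Rightarrow> 'k) \<Rightarrow> 'k::real_normed_field"
  assumes flat: "flat_at_zero n g" and "0 < n"
  obtains \<rho> where "0 < \<rho>" "\<And>a. (\<And>i. i < n \<Longrightarrow> norm (a i) \<le> W) \<Longrightarrow>
      continuous_on (ball 0 \<rho>) (\<lambda>s. inverse s * g (\<lambda>i. s * a i))"
proof -
  obtain \<delta> where \<delta>: "0 < \<delta>"
    "\<And>x y B. (\<And>i. i < n \<Longrightarrow> norm (x i) \<le> \<delta>) \<Longrightarrow> (\<And>i. i < n \<Longrightarrow> norm (y i) \<le> \<delta>) \<Longrightarrow>
      (\<And>i. i < n \<Longrightarrow> norm (x i - y i) \<le> B) \<Longrightarrow> norm (g x - g y) \<le> 1 * B"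
    using flat_at_zeroD[OF flat zero_less_one] by metis
  have "continuous_on (ball 0 (\<delta> / (\<bar>W\<bar> + 1))) (\<lambda>s. inverse s * g (\<lambda>i. s * a i))"
    if a: "\<And>i. i < n \<Longrightarrow> norm (a i) \<le> W" for a
    unfolding continuous_on_eq_continuous_at[OF open_ball]
  proof
    fix p :: 'k assume "p \<in> ball 0 (\<delta> / (\<bar>W\<bar> + 1))"
    then have p: "norm p < \<delta> / (\<bar>W\<bar> + 1)" by simp
    have W: "0 \<le> W" using a[OF \<open>0 < n\<close>] norm_ge_zero order_trans by blast
    have in_ball: "norm (s * a i) \<le> \<delta>" if "norm s < \<delta> / (\<bar>W\<bar> + 1)" "i < n" for s i
    proof -
      have "norm (s * a i) \<le> norm s * W"
        using a[OF that(2)] by (simp add: norm_mult mult_left_mono)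
      also have "\<dots> \<le> norm s * (\<bar>W\<bar> + 1)" by (intro mult_left_mono) auto
      also have "\<dots> \<le> \<delta>" using that(1) by (simp add: pos_less_divide_eq)
      finally show ?thesis .
    qed
    show "isCont (\<lambda>s. inverse s * g (\<lambda>i. s * a i)) p"
    proof (cases "p = 0")
      case False
      have near: "\<forall>\<^sub>F s in at p. norm s < \<delta> / (\<bar>W\<bar> + 1)"
        using p by (intro order_tendstoD(2)[of norm "norm p"] tendsto_norm) auto
      have "((\<lambda>s. g (\<lambda>i. s * a i) - g (\<lambda>i. p * a i)) \<longlongrightarrow> 0) (at p)"
      proof (rule Lim_null_comparison)
        show "\<forall>\<^sub>F s in at p. norm (g (\<lambda>i. s * a i) - g (\<lambda>i. p * a i)) \<le> norm (s - p) * W"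
          using near
        proof eventually_elim
          case (elim s)
          have "norm (g (\<lambda>i. s * a i) - g (\<lambda>i. p * a i)) \<le> 1 * (norm (s - p) * W)"
          proof (rule \<delta>(2))
            show "norm (s * a i - p * a i) \<le> norm (s - p) * W" if "i < n" for i
              using a[OF that] by (simp add: left_diff_distrib[symmetric] norm_mult mult_left_mono)
          qed (use in_ball elim p in auto)
          then show ?case by simp
        qed
        have "((\<lambda>s. norm (s - p) * W) \<longlongrightarrow> norm (p - p) * W) (at p)"
          by (intro tendsto_intros)
        then show "((\<lambda>s. norm (s - p) * W) \<longlongrightarrow> 0) (at p)" by simp
      qed
      then have "((\<lambda>s. g (\<lambda>i. s * a i)) \<longlongrightarrow> g (\<lambda>i. p * a i)) (at p)"
        by (simp add: LIM_zero_iff)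
      then show ?thesis
        using False unfolding isCont_def by (intro tendsto_mult tendsto_inverse) auto
    next
      case True
      have "((\<lambda>s. inverse s * g (\<lambda>i. s * a i)) \<longlongrightarrow> 0) (at 0)"
        unfolding tendsto_iff dist_norm
      proof (intro allI impI)
        fix e :: real assume e: "0 < e"
        then have "0 < e / (W + 1)" using W by simp
        then obtain d where d: "0 < d"
          "\<And>x y B. (\<And>i. i < n \<Longrightarrow> norm (x i) \<le> d) \<Longrightarrow> (\<And>i. i < n \<Longrightarrow> norm (y i) \<le> d) \<Longrightarrow>
            (\<And>i. i < n \<Longrightarrow> norm (x i - y i) \<le> B) \<Longrightarrow> norm (g x - g y) \<le> e / (W + 1) * B"
          using flat_at_zeroD[OF flat] by metis
        have "0 < d / (W + 1)" using d W by simp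
        then have "\<forall>\<^sub>F s in at 0. norm s < d / (W + 1)"
          by (intro order_tendstoD(2)[of norm 0]) (auto intro: tendsto_norm_zero tendsto_ident_at)
        then show "\<forall>\<^sub>F s in at 0. norm (inverse s * g (\<lambda>i. s * a i) - 0) < e"
        proof eventually_elim
          case (elim s)
          have sW: "norm (s * a i) \<le> norm s * W" if "i < n" for i
            using a[OF that] by (simp add: norm_mult mult_left_mono)
          have "norm s * W \<le> d"
            using elim W mult_left_mono[of W "W + 1" "norm s"] by (simp add: pos_less_divide_eq)
          then have "norm (g (\<lambda>i. s * a i) - g (\<lambda>_. 0)) \<le> e / (W + 1) * (norm s * W)"
            using sW d(1) by (intro d(2)) force+
          moreover have "g (\<lambda>_. 0) = 0" using flat by (simp add: flat_at_zero_def)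
          ultimately have "norm (inverse s * g (\<lambda>i. s * a i)) \<le> e / (W + 1) * W"
            using e W by (intro norm_inverse_mult_le) auto
          also have "\<dots> = e * (W / (W + 1))" by simp
          also have "\<dots> < e * 1" using e W by (intro mult_strict_left_mono) (auto simp: pos_divide_less_eq)
          finally show ?case by simp
        qed
      qed
      then show ?thesis using True by (simp add: isCont_def)
    qed
  qed
  moreover have "0 < \<delta> / (\<bar>W\<bar> + 1)" using \<delta>(1) by (simp add: add_nonneg_pos)
  ultimately show ?thesis using that by blast
qed

text \<open>The system \<open>M x + G x = 0\<close> has a linear part \<open>M\<close> whose kernel is spanned by \<open>v\<close>, and its rows
  satisfy one linear relation. With \<open>x = s (v + u)\<close> and \<open>M v = 0\<close>, division by \<open>s\<close> turns it into
  \<open>M u = - r\<close> with \<open>r = G (s (v + u)) / s\<close>, where \<open>r\<close> has small Lipschitz constant in \<open>u\<close> and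
  entries adding up to zero. The singular \<open>M\<close> may be replaced by \<open>M + J\<close> with \<open>J\<close> the matrix of all
  ones: summing the rows of \<open>(M + J) u = - r\<close> shows that the entries of \<open>u\<close> add up to zero, so
  \<open>J u = 0\<close>. And \<open>M + J\<close> is invertible, since in its kernel the same argument leaves only multiples
  of \<open>v\<close> with vanishing sum. So \<open>u\<close> is the fixed point of a contraction that depends
  continuously on \<open>s\<close>.\<close>

lemma redundant_system_solution_curve:
  fixes M :: "nat \<Rightarrow> nat \<Rightarrow> real" and G :: "nat \<Rightarrow> (nat \<Rightarrow> 'k) \<Rightarrow> 'k::{real_normed_field, banach}"
  assumes n: "0 < n"
    and flat: "\<And>q. q < n \<Longrightarrow> flat_at_zero n (G q)"
    and redundant: "\<And>x. (\<Sum>q<n. G q x) = 0"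
    and column_sums: "\<And>i. i < n \<Longrightarrow> (\<Sum>q<n. M q i) = 0"
    and v_pos: "\<And>i. i < n \<Longrightarrow> 0 < v i"
    and v_ker: "\<And>q. q < n \<Longrightarrow> (\<Sum>i<n. M q i * v i) = 0"
    and kernel: "\<And>u. (\<And>q. q < n \<Longrightarrow> (\<Sum>i<n. M q i * u i) = 0) \<Longrightarrow> \<exists>t. \<forall>i<n. u i = t * v i"
  obtains \<delta> :: real and U :: "'k \<Rightarrow> nat \<Rightarrow> 'k" where "0 < \<delta>"
    "\<And>i. continuous_on (ball 0 \<delta>) (\<lambda>s. U s i)" "\<And>i. U 0 i = 0"
    "\<And>s q. norm s < \<delta> \<Longrightarrow> q < n \<Longrightarrow>
      (\<Sum>i<n. M q i *\<^sub>R (s * (of_real (v i) + U s i))) + G q (\<lambda>i. s * (of_real (v i) + U s i)) = 0"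
proof -
  have "\<exists>L. \<forall>q<n. \<forall>k<n. (\<Sum>i<n. (M q i + 1) * L i k) = (if q = k then 1 else 0)"
  proof (rule injective_square_system_right_inverse)
    fix x :: "nat \<Rightarrow> real" and j
    assume x: "\<And>q. q < n \<Longrightarrow> (\<Sum>i<n. (M q i + 1) * x i) = 0" and "j < n"
    have "(\<Sum>q<n. \<Sum>i<n. (M q i + 1) * x i) = 0" using x by simp
    then have "(\<Sum>i<n. x i) = 0"
      using sum_of_rows_zero[of n M x] column_sums n by (simp add: distrib_right sum.distrib)
    then have "(\<Sum>i<n. M q i * x i) = 0" if "q < n" for q
      using x[OF that] by (simp add: distrib_right sum.distrib)
    then obtain t where t: "\<And>i. i < n \<Longrightarrow> x i = t * v i" using kernel[of x] by blast
    have "t * (\<Sum>i<n. v i) = 0"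
      using \<open>(\<Sum>i<n. x i) = 0\<close> t by (simp add: sum_distrib_left)
    moreover have "0 < (\<Sum>i<n. v i)" using v_pos n by (intro sum_pos) auto
    ultimately show "x j = 0" using t \<open>j < n\<close> by simp
  qed
  then obtain L where L: "\<And>q k. q < n \<Longrightarrow> k < n \<Longrightarrow> (\<Sum>i<n. (M q i + 1) * L i k) = (if q = k then 1 else 0)"
    by blast
  define W where "W = 1 + (\<Sum>i<n. \<bar>v i\<bar>)"
  define \<Lambda> where "\<Lambda> = 1 + (\<Sum>i<n. \<Sum>q<n. \<bar>L i q\<bar>)"
  have W: "1 \<le> W" and \<Lambda>: "1 \<le> \<Lambda>" by (auto simp: W_def \<Lambda>_def intro!: sum_nonneg)
  \<comment> \<open>\<open>W\<close> bounds the entries of \<open>v + u\<close> and \<open>\<Lambda>\<close> the operator norm of \<open>L\<close>; so the map \<open>T\<close> below has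
    contraction factor \<open>1 / 2\<close> and values of norm at most \<open>1 / 2\<close>.\<close>
  define \<epsilon> where "\<epsilon> = 1 / (2 * \<Lambda> * W)"
  have \<epsilon>: "0 < \<epsilon>" using W \<Lambda> by (simp add: \<epsilon>_def)
  then obtain d where d: "0 < d"
    "\<And>x y B q. (\<And>i. i < n \<Longrightarrow> norm (x i) \<le> d) \<Longrightarrow> (\<And>i. i < n \<Longrightarrow> norm (y i) \<le> d) \<Longrightarrow>
      (\<And>i. i < n \<Longrightarrow> norm (x i - y i) \<le> B) \<Longrightarrow> q < n \<Longrightarrow> norm (G q x - G q y) \<le> \<epsilon> * B"
    using flat_at_zero_uniform[where G = G and n = n, OF flat _ n] by metis
  have "\<exists>\<rho>>0. q < n \<longrightarrow> (\<forall>a. (\<forall>i<n. norm (a i) \<le> W) \<longrightarrow>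
      continuous_on (ball 0 \<rho>) (\<lambda>s. inverse s * G q (\<lambda>i. s * a i)))" for q
  proof (cases "q < n")
    case True
    obtain \<rho> where "0 < \<rho>" "\<And>a. (\<And>i. i < n \<Longrightarrow> norm (a i) \<le> W) \<Longrightarrow>
        continuous_on (ball 0 \<rho>) (\<lambda>s. inverse s * G q (\<lambda>i. s * a i))"
      using flat_rescaling_continuous[where W = W, OF flat[OF True] n] by blast
    then show ?thesis by (intro exI[of _ \<rho>]) simp
  qed (use zero_less_one in blast)
  then obtain \<rho> where \<rho>: "\<And>q. 0 < \<rho> q" "\<And>q a. q < n \<Longrightarrow> (\<And>i. i < n \<Longrightarrow> norm (a i) \<le> W) \<Longrightarrow>
      continuous_on (ball 0 (\<rho> q)) (\<lambda>s. inverse s * G q (\<lambda>i. s * a i))"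
    by metis
  define \<delta> where "\<delta> = min (d / W) (Min (\<rho> ` {..<n}))"
  have \<delta>: "0 < \<delta>" "\<delta> \<le> d / W" "\<And>q. q < n \<Longrightarrow> \<delta> \<le> \<rho> q"
    using d(1) W \<rho>(1) n by (auto simp: \<delta>_def min_le_iff_disj Min_gr_iff lessThan_empty_iff)
  define X where "X s u = (\<lambda>i. s * (of_real (v i) + apply_bcontfun u i))" for s :: 'k and u
  define T where "T s u = truncate n (\<lambda>i. - (\<Sum>q<n. L i q *\<^sub>R (inverse s * G q (X s u))))"
    for s :: 'k and u
  have entry: "norm (of_real (v i) + apply_bcontfun u i) \<le> W" if "u \<in> cball 0 1" "i < n"
    for u :: "nat \<Rightarrow>\<^sub>C 'k" and i
  proof -
    have "norm (apply_bcontfun u i) \<le> 1" using norm_bounded[of u i] that(1) by simp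
    moreover have "\<bar>v i\<bar> \<le> (\<Sum>i<n. \<bar>v i\<bar>)" using that(2) by (intro member_le_sum) auto
    ultimately show ?thesis
      unfolding W_def by (intro order_trans[OF norm_triangle_ineq]) simp
  qed
  have X_small: "norm (X s u i) \<le> d" if "u \<in> cball 0 1" "i < n" "s \<in> ball 0 \<delta>" for s u i
  proof -
    have "norm (X s u i) \<le> norm s * W"
      using entry[OF that(1,2)] by (simp add: X_def norm_mult mult_left_mono)
    also have "\<dots> \<le> d / W * W" using that(3) \<delta>(2) W by (intro mult_right_mono) auto
    finally show ?thesis using W by simp
  qed
  have L_bound: "norm (\<Sum>q<n. L i q *\<^sub>R r q) \<le> \<Lambda> * b"
    if "i < n" "0 \<le> b" "\<And>q. q < n \<Longrightarrow> norm (r q) \<le> b" for i b and r :: "nat \<Rightarrow> 'k"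
  proof -
    have "norm (\<Sum>q<n. L i q *\<^sub>R r q) \<le> (\<Sum>q<n. \<bar>L i q\<bar> * b)"
      using that(3) by (intro order_trans[OF norm_sum] sum_mono) (auto intro!: mult_left_mono)
    also have "\<dots> = (\<Sum>q<n. \<bar>L i q\<bar>) * b" by (simp add: sum_distrib_right)
    also have "\<dots> \<le> (\<Sum>i<n. \<Sum>q<n. \<bar>L i q\<bar>) * b"
      using that(1,2) by (intro mult_right_mono member_le_sum[of i _ "\<lambda>i. \<Sum>q<n. \<bar>L i q\<bar>"])
        (auto intro!: sum_nonneg)
    finally show ?thesis using that(2) by (simp add: \<Lambda>_def distrib_right)
  qed
  have half: "\<Lambda> * (\<epsilon> * b) \<le> b / 2" if "0 \<le> b" for b
  proof -
    have "\<Lambda> * (\<epsilon> * b) = (b / 2) * (1 / W)" using \<Lambda> W by (simp add: \<epsilon>_def)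
    also have "\<dots> \<le> (b / 2) * 1" using W that by (intro mult_left_mono) auto
    finally show ?thesis by simp
  qed
  have T_self: "T s u \<in> cball 0 1" if "s \<in> ball 0 \<delta>" "u \<in> cball 0 1" for s u
  proof -
    have "norm (inverse s * G q (X s u)) \<le> \<epsilon> * W" if "q < n" for q
    proof -
      have "norm (G q (X s u) - G q (\<lambda>_. 0)) \<le> \<epsilon> * (norm s * W)"
      proof (rule d(2)[OF _ _ _ \<open>q < n\<close>])
        show "norm (X s u i - 0) \<le> norm s * W" if "i < n" for i
          using entry[OF \<open>u \<in> cball 0 1\<close> that] by (simp add: X_def norm_mult mult_left_mono)
      qed (use X_small \<open>u \<in> cball 0 1\<close> \<open>s \<in> ball 0 \<delta>\<close> d(1) in auto)
      moreover have "G q (\<lambda>_. 0) = 0" using flat[OF \<open>q < n\<close>] by (simp add: flat_at_zero_def)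
      ultimately show ?thesis
        using \<epsilon> W by (intro norm_inverse_mult_le) auto
    qed
    then have bd: "norm (\<Sum>q<n. L i q *\<^sub>R (inverse s * G q (X s u))) \<le> \<Lambda> * (\<epsilon> * W)" if "i < n" for i
      using \<epsilon> W that by (intro L_bound) auto
    have "\<Lambda> * (\<epsilon> * W) = 1 / 2" using \<Lambda> W by (simp add: \<epsilon>_def)
    then have "dist (T s u) (truncate n (\<lambda>_. 0)) \<le> 1"
      unfolding T_def using bd by (intro dist_truncate_le) force+
    then show ?thesis by (simp add: truncate_zero)
  qed
  have T_contr: "dist (T s u) (T s u') \<le> (1 / 2) * dist u u'"
    if "s \<in> ball 0 \<delta>" "u \<in> cball 0 1" "u' \<in> cball 0 1" for s u u'
  proof -
    have "norm (inverse s * G q (X s u) - inverse s * G q (X s u')) \<le> \<epsilon> * dist u u'" if "q < n" for q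
    proof -
      have "norm (G q (X s u) - G q (X s u')) \<le> \<epsilon> * (norm s * dist u u')"
      proof (rule d(2)[OF _ _ _ \<open>q < n\<close>])
        show "norm (X s u i - X s u' i) \<le> norm s * dist u u'" for i
        proof -
          have "X s u i - X s u' i = s * apply_bcontfun (u - u') i"
            by (simp add: X_def algebra_simps)
          then show ?thesis
            using norm_bounded[of "u - u'" i] by (simp add: norm_mult dist_norm mult_left_mono)
        qed
      qed (use X_small that \<open>u \<in> cball 0 1\<close> \<open>u' \<in> cball 0 1\<close> \<open>s \<in> ball 0 \<delta>\<close> in auto)
      then have "norm (inverse s * (G q (X s u) - G q (X s u'))) \<le> \<epsilon> * dist u u'"
        using \<epsilon> by (intro norm_inverse_mult_le) auto
      then show ?thesis by (simp add: right_diff_distrib)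
    qed
    then have "norm (\<Sum>q<n. L i q *\<^sub>R (inverse s * G q (X s u) - inverse s * G q (X s u'))) \<le> \<Lambda> * (\<epsilon> * dist u u')"
      if "i < n" for i using \<epsilon> that by (intro L_bound) auto
    then have "norm (- (\<Sum>q<n. L i q *\<^sub>R (inverse s * G q (X s u))) - - (\<Sum>q<n. L i q *\<^sub>R (inverse s * G q (X s u'))))
        \<le> dist u u' / 2" if "i < n" for i
      using half[of "dist u u'"] that
      by (force simp: scaleR_right_diff_distrib sum_subtractf norm_minus_commute)
    then have "dist (T s u) (T s u') \<le> dist u u' / 2"
      unfolding T_def by (rule dist_truncate_le) auto
    then show ?thesis by simp
  qed
  have T_cont: "continuous_on (ball 0 \<delta>) (\<lambda>s. T s u)" if "u \<in> cball 0 1" for u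
    unfolding T_def
  proof (intro continuous_on_truncate continuous_on_minus continuous_on_sum continuous_on_scaleR continuous_on_const)
    fix q assume "q \<in> {..<n}"
    then have "continuous_on (ball 0 (\<rho> q)) (\<lambda>s. inverse s * G q (X s u))"
      unfolding X_def using entry[OF that] by (intro \<rho>(2)) auto
    then show "continuous_on (ball 0 \<delta>) (\<lambda>s. inverse s * G q (X s u))"
      by (rule continuous_on_subset) (use \<delta>(3) \<open>q \<in> {..<n}\<close> in \<open>auto intro!: subset_ball\<close>)
  qed
  have "complete (cball (0 :: nat \<Rightarrow>\<^sub>C 'k) 1)" "cball (0 :: nat \<Rightarrow>\<^sub>C 'k) 1 \<noteq> {}"
    by (auto intro: complete_closed_subset[OF closed_cball _ complete_bounded_continuous_functions])
  from contraction_fixed_point_continuous[OF this _ _ T_self T_contr T_cont]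
  obtain Y where Y: "continuous_on (ball 0 \<delta>) Y" "\<And>s. s \<in> ball 0 \<delta> \<Longrightarrow> Y s \<in> cball 0 1"
    "\<And>s. s \<in> ball 0 \<delta> \<Longrightarrow> T s (Y s) = Y s"
    by auto
  define U where "U s i = apply_bcontfun (Y s) i" for s i
  have U_cont: "continuous_on (ball 0 \<delta>) (\<lambda>s. U s i)" for i
    unfolding continuous_on_def
  proof
    fix p :: 'k assume "p \<in> ball 0 \<delta>"
    then have "((\<lambda>s. dist (Y s) (Y p)) \<longlongrightarrow> 0) (at p within ball 0 \<delta>)"
      using Y(1) unfolding continuous_on_def by (subst tendsto_dist_iff[symmetric]) blast
    then have "((\<lambda>s. dist (U s i) (U p i)) \<longlongrightarrow> 0) (at p within ball 0 \<delta>)"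
      by (rule tendsto_sandwich[of "\<lambda>_. 0", rotated -1])
        (auto simp: U_def dist_bounded)
    then show "((\<lambda>s. U s i) \<longlongrightarrow> U p i) (at p within ball 0 \<delta>)" by (subst tendsto_dist_iff)
  qed
  have "Y 0 = 0"
    using Y(3)[of 0] \<delta>(1) by (simp add: T_def truncate_zero)
  then have U_0: "U 0 i = 0" for i by (simp add: U_def)
  have "(\<Sum>i<n. M q i *\<^sub>R (s * (of_real (v i) + U s i))) + G q (\<lambda>i. s * (of_real (v i) + U s i)) = 0"
    if s: "norm s < \<delta>" and q: "q < n" for s q
  proof -
    define r where "r k = inverse s * G k (X s (Y s))" for k
    have U: "U s i = - (\<Sum>k<n. L i k *\<^sub>R r k)" if "i < n" for i
      using Y(3)[of s] s that unfolding U_def T_def r_def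
      by (metis (no_types, lifting) apply_truncate mem_ball_0)
    have eq: "(\<Sum>i<n. (M p i + 1) *\<^sub>R U s i) = - r p" if "p < n" for p
    proof -
      have "(\<Sum>i<n. (M p i + 1) *\<^sub>R U s i) = - (\<Sum>i<n. \<Sum>k<n. ((M p i + 1) * L i k) *\<^sub>R r k)"
        by (simp add: U sum_negf scaleR_sum_right)
      also have "\<dots> = - (\<Sum>k<n. (\<Sum>i<n. (M p i + 1) * L i k) *\<^sub>R r k)"
        by (subst sum.swap) (simp add: scaleR_sum_left)
      also have "\<dots> = - (\<Sum>k<n. if k = p then r k else 0)"
        using L[OF that] by (intro arg_cong[of _ _ uminus] sum.cong) auto
      finally show ?thesis using that by simp
    qed
    have "(\<Sum>p<n. \<Sum>i<n. (M p i + 1) *\<^sub>R U s i) = of_nat n * (\<Sum>i<n. U s i)"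
      using sum_of_rows_zero[of n M "U s"] column_sums by (simp add: scaleR_left_distrib sum.distrib)
    moreover have "(\<Sum>p<n. \<Sum>i<n. (M p i + 1) *\<^sub>R U s i) = - (inverse s * (\<Sum>p<n. G p (X s (Y s))))"
      using eq by (simp add: r_def sum_negf sum_distrib_left)
    ultimately have "(\<Sum>i<n. U s i) = 0" using redundant n by simp
    then have MU: "(\<Sum>i<n. M q i *\<^sub>R U s i) = - r q"
      using eq[OF q] by (simp add: scaleR_left_distrib sum.distrib)
    have "(\<Sum>i<n. M q i *\<^sub>R (of_real (v i) :: 'k)) = of_real (\<Sum>i<n. M q i * v i)"
      by (simp add: scaleR_conv_of_real)
    then have Mv: "(\<Sum>i<n. M q i *\<^sub>R (of_real (v i) :: 'k)) = 0" using v_ker[OF q] by simp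
    have "(\<Sum>i<n. M q i *\<^sub>R (s * (of_real (v i) + U s i)))
        = s * ((\<Sum>i<n. M q i *\<^sub>R of_real (v i)) + (\<Sum>i<n. M q i *\<^sub>R U s i))"
      by (simp add: sum_distrib_left sum.distrib[symmetric] algebra_simps)
    also have "\<dots> = - (s * r q)" by (simp add: Mv MU)
    also have "s * r q = G q (X s (Y s))"
    proof (cases "s = 0")
      case True
      then show ?thesis using flat[OF q] by (simp add: X_def flat_at_zero_def)
    qed (simp add: r_def)
    finally show ?thesis by (simp add: X_def U_def)
  qed
  then show ?thesis using that \<delta>(1) U_cont U_0 by blast
qed

section \<open>Corners of the tetrahedra around the edges\<close>

text \<open>Corners are the dihedral angles at the edges of a tetrahedron, which agree at opposite edges:
  \<open>ZCorner\<close> carries \<open>z\<close>, while \<open>Corner R\<close> carries \<open>x\<close> and \<open>Corner L\<close> carries \<open>y\<close>. The index is the letter whose strings begin with an edge whose squared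
  factors are of that kind, which puts \<open>x\<close> and \<open>y\<close> on the same footing.\<close>

datatype corner = ZCorner | Corner letter

lemma corner_letter_cases:
  obtains "\<kappa> = ZCorner" | "\<kappa> = Corner R" | "\<kappa> = Corner L"
  by (metis corner.exhaust letter.exhaust)

definition prev :: "letter list \<Rightarrow> nat \<Rightarrow> nat" where
  "prev w i = (i + length w - 1) mod length w"

definition succ :: "letter list \<Rightarrow> nat \<Rightarrow> nat" where
  "succ w i = Suc i mod length w"

definition other_letter :: "letter \<Rightarrow> letter" where
  "other_letter c = (case c of R \<Rightarrow> L | L \<Rightarrow> R)"

text \<open>The factors of an edge holonomy as formal symbols, with the tetrahedra reduced modulo the length of
  the word. Unlike the list of values it can be counted and summed over independently of the field.\<close>

definition edge_corners :: "letter list \<Rightarrow> nat \<Rightarrow> (corner \<times> nat) list" where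
  "edge_corners w q =
     (let k = string_end w q; N = length w
      in if string_start w q
         then [(ZCorner, prev w q)]
              @ concat (map (\<lambda>i. [(Corner (w ! q), i mod N), (Corner (w ! q), i mod N)]) [q..<k + 2])
              @ [(ZCorner, (k + 2) mod N)]
         else [(ZCorner, prev w q), (Corner (other_letter (w ! q)), q mod N),
               (Corner (other_letter (w ! q)), q mod N), (ZCorner, succ w q)])"

fun shape :: "corner \<Rightarrow> 'a::{comm_ring_1, inverse} \<Rightarrow> 'a" where
  "shape ZCorner z = z"
| "shape (Corner R) z = shape_x z"
| "shape (Corner L) z = shape_y z"

lemma edge_factors_eq: "edge_factors w z q = map (\<lambda>(\<kappa>, i). shape \<kappa> (z i)) (edge_corners w q)"
proof -
  have "map (\<lambda>(\<kappa>, i). shape \<kappa> (z i)) (concat (map (\<lambda>i. [(\<kappa>, i mod n), (\<kappa>, i mod n)]) xs))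
      = concat (map (\<lambda>i. [shape \<kappa> (z (i mod n)), shape \<kappa> (z (i mod n))]) xs)" for \<kappa> n xs
    by (induction xs) auto
  then show ?thesis
    by (auto simp: edge_factors_def edge_corners_def Let_def cyc_def cyc_pred_def prev_def succ_def
        other_letter_def simp del: upt_Suc split: letter.split)
qed

definition edge_sum :: "letter list \<Rightarrow> (corner \<Rightarrow> nat \<Rightarrow> 'm::comm_monoid_add) \<Rightarrow> nat \<Rightarrow> 'm" where
  "edge_sum w f q = (\<Sum>(\<kappa>, i)\<leftarrow>edge_corners w q. f \<kappa> i)"

text \<open>The set is never empty, as \<open>0\<close> starts a string.\<close>

definition start_of :: "letter list \<Rightarrow> nat \<Rightarrow> nat" where
  "start_of w i = Max {q. q \<le> i \<and> string_start w q}"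

text \<open>The unique edge at which both corners of the kind \<open>Corner c\<close> of tetrahedron \<open>i\<close> lie.\<close>

definition corner_edge :: "letter list \<Rightarrow> letter \<Rightarrow> nat \<Rightarrow> nat" where
  "corner_edge w c i =
     (if w ! i = c then start_of w i
      else if string_start w i then start_of w (prev w i) else i)"

text \<open>The corners \<open>Corner c\<close> at an edge \<open>q\<close> come from consecutive tetrahedra, from \<open>q\<close> to \<open>fan_end w q\<close>;
  this fan is enclosed by a \<open>ZCorner\<close> of the tetrahedron before it and one of the tetrahedron after
  it.\<close>

definition fan_end :: "letter list \<Rightarrow> nat \<Rightarrow> nat" where
  "fan_end w q = (if string_start w q then Suc (string_end w q) mod length w else q)"

lemma two_letters: "a \<noteq> b \<Longrightarrow> c \<noteq> b \<Longrightarrow> a = (c::letter)"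
  by (cases a; cases b; cases c) auto

text \<open>Words that are read cyclically, cut between two different letters so that no string of equal
  letters passes through the cut.\<close>

locale cyclic_word =
  fixes w :: "letter list" and N :: nat
  defines "N \<equiv> length w"
  assumes nonempty: "0 < N" and ends_differ: "w ! (N - 1) \<noteq> w ! 0"
begin

lemma N_ge_2: "2 \<le> N"
proof (rule ccontr)
  assume "\<not> 2 \<le> N"
  then have "N - 1 = 0" by simp
  with ends_differ show False by simp
qed

lemma prev_eq: "i < N \<Longrightarrow> prev w i = (if i = 0 then N - 1 else i - 1)"
  by (auto simp: prev_def N_def[symmetric] mod_if)

lemma prev_less: "i < N \<Longrightarrow> prev w i < N"
  by (auto simp: prev_eq)

lemma succ_less: "succ w i < N"
  using nonempty by (simp add: succ_def N_def)

lemma prev_neq: "i < N \<Longrightarrow> prev w i \<noteq> i"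
  using N_ge_2 by (auto simp: prev_eq)

lemma succ_prev: "i < N \<Longrightarrow> succ w (prev w i) = i"
  by (auto simp: prev_eq succ_def N_def[symmetric])

lemma prev_succ: "i < N \<Longrightarrow> prev w (succ w i) = i"
  by (cases "Suc i = N") (auto simp: prev_eq succ_def N_def[symmetric])

lemma string_start_iff: "i < N \<Longrightarrow> string_start w i \<longleftrightarrow> w ! prev w i \<noteq> w ! i"
  using ends_differ by (auto simp: string_start_def prev_eq)

lemma string_end_props:
  assumes "q < N"
  shows "q \<le> string_end w q" "string_end w q < N"
    "Suc (string_end w q) = N \<or> w ! Suc (string_end w q) \<noteq> w ! q"
    "\<And>i. q \<le> i \<Longrightarrow> i \<le> string_end w q \<Longrightarrow> w ! i = w ! q"
proof -
  define P where "P k \<longleftrightarrow> q \<le> k \<and> (Suc k = N \<or> w ! Suc k \<noteq> w ! q)" for k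
  have E: "string_end w q = (LEAST k. P k)" by (simp add: string_end_def P_def N_def)
  have "P (N - 1)" using assms by (auto simp: P_def)
  then have P: "P (string_end w q)" "string_end w q \<le> N - 1"
    unfolding E by (auto intro: LeastI Least_le)
  then show "q \<le> string_end w q" "string_end w q < N"
    "Suc (string_end w q) = N \<or> w ! Suc (string_end w q) \<noteq> w ! q"
    using nonempty by (auto simp: P_def)
  fix i assume "q \<le> i" "i \<le> string_end w q"
  then show "w ! i = w ! q"
  proof (induction i rule: dec_induct)
    case (step i)
    then have "\<not> P i" using not_less_Least[of i P] by (simp add: E)
    then show ?case using step by (auto simp: P_def)
  qed simp
qed

lemma not_start_inside:
  assumes "q < N" "q < i" "i \<le> string_end w q"
  shows "\<not> string_start w i"
  using string_end_props(4)[OF assms(1), of i] string_end_props(4)[OF assms(1), of "i - 1"] assms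
  by (auto simp: string_start_def)

lemma start_of_props:
  shows "start_of w i \<le> i" "string_start w (start_of w i)"
    "\<And>q. start_of w i < q \<Longrightarrow> q \<le> i \<Longrightarrow> \<not> string_start w q"
proof -
  have fin: "finite {q. q \<le> i \<and> string_start w q}" by simp
  have "0 \<in> {q. q \<le> i \<and> string_start w q}" by (simp add: string_start_def)
  then have "start_of w i \<in> {q. q \<le> i \<and> string_start w q}"
    unfolding start_of_def using fin by (metis Max_in empty_iff)
  then show "start_of w i \<le> i" "string_start w (start_of w i)" by auto
  show "\<not> string_start w q" if "start_of w i < q" "q \<le> i" for q
  proof
    assume "string_start w q"
    then have "q \<le> start_of w i"
      unfolding start_of_def using that fin by (intro Max_ge) auto
    then show False using that by simp
  qed
qed

lemma start_of_eq_iff: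
  assumes "q < N" "i < N"
  shows "start_of w i = q \<longleftrightarrow> string_start w q \<and> q \<le> i \<and> i \<le> string_end w q"
proof
  assume q: "start_of w i = q"
  have "i \<le> string_end w q"
  proof (rule ccontr)
    assume "\<not> i \<le> string_end w q"
    then have "Suc (string_end w q) \<le> i" by simp
    moreover have "w ! Suc (string_end w q) \<noteq> w ! string_end w q"
      using string_end_props(1-3)[OF assms(1)] string_end_props(4)[OF assms(1), of "string_end w q"]
        calculation assms(2) by (metis le_refl not_le)
    ultimately have "string_start w (Suc (string_end w q))" "q < Suc (string_end w q)"
      using string_end_props(1)[OF assms(1)] by (auto simp: string_start_def)
    with start_of_props(3)[of i] q \<open>Suc (string_end w q) \<le> i\<close> show False by blast
  qed
  then show "string_start w q \<and> q \<le> i \<and> i \<le> string_end w q"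
    using start_of_props(1,2)[of i] q by simp
next
  assume q: "string_start w q \<and> q \<le> i \<and> i \<le> string_end w q"
  have "\<not> q < start_of w i"
    using not_start_inside[OF assms(1), of "start_of w i"] start_of_props[of i] q by fastforce
  moreover have "\<not> start_of w i < q"
    using start_of_props(3)[of i q] q by blast
  ultimately show "start_of w i = q" by simp
qed

lemma start_of_less: "i < N \<Longrightarrow> start_of w i < N"
  using start_of_props(1)[of i] by simp

lemma letter_start_of: "i < N \<Longrightarrow> w ! start_of w i = w ! i"
  using start_of_eq_iff[of "start_of w i" i] string_end_props(4)[of "start_of w i" i] start_of_less[of i]
  by simp

lemma corner_edge_less: "i < N \<Longrightarrow> corner_edge w c i < N"
  using start_of_less prev_less by (auto simp: corner_edge_def)

lemma next_start:
  assumes "q < N"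
  shows "string_start w (Suc (string_end w q) mod N)" "w ! (Suc (string_end w q) mod N) \<noteq> w ! q"
    "prev w (Suc (string_end w q) mod N) = string_end w q"
proof -
  let ?i = "Suc (string_end w q) mod N"
  show p: "prev w ?i = string_end w q"
    using prev_succ[OF string_end_props(2)[OF assms]] by (simp add: succ_def N_def)
  have e: "w ! string_end w q = w ! q"
    by (intro string_end_props(4)[OF assms] string_end_props(1)[OF assms] order_refl)
  show d: "w ! ?i \<noteq> w ! q"
  proof (cases "Suc (string_end w q) = N")
    case True
    then have "w ! (N - 1) = w ! q" using e by auto
    then show ?thesis using True ends_differ by auto
  next
    case False
    then show ?thesis using string_end_props(2,3)[OF assms] by auto
  qed
  show "string_start w ?i"
    using d e p nonempty by (subst string_start_iff) auto
qed

text \<open>The start \<open>q\<close> of a string sees the corners \<open>Corner c\<close>, for \<open>c\<close> the letter of the string, of all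
  tetrahedra of the string and of the first tetrahedron of the next one. Any other \<open>q\<close> sees only the
  corners of the opposite kind of tetrahedron \<open>q\<close> itself.\<close>

lemma corner_edge_fibre:
  assumes "q < N"
  shows "{i. i < N \<and> corner_edge w c i = q} =
    (if string_start w q
     then if w ! q = c then insert (Suc (string_end w q) mod N) {q..string_end w q} else {}
     else if w ! q = c then {} else {q})"
proof (cases "string_start w q")
  case True
  note E = string_end_props[OF assms]
  show ?thesis
  proof (cases "w ! q = c")
    case qc: True
    have "i < N \<and> corner_edge w c i = q \<longleftrightarrow> i = Suc (string_end w q) mod N \<or> q \<le> i \<and> i \<le> string_end w q"
      (is "?A \<longleftrightarrow> ?B") for i
    proof
      assume A: ?A
      show ?B
      proof (cases "w ! i = c")
        case True
        then show ?thesis using A start_of_eq_iff[OF assms, of i] by (auto simp: corner_edge_def)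
      next
        case False
        then have "string_start w i"
          using A \<open>string_start w q\<close> by (auto simp: corner_edge_def split: if_splits)
        then have p: "q \<le> prev w i" "prev w i \<le> string_end w q"
          using A False start_of_eq_iff[OF assms, of "prev w i"] prev_less
          by (auto simp: corner_edge_def)
        have "prev w i = string_end w q"
        proof (rule ccontr)
          assume "prev w i \<noteq> string_end w q"
          then have lt: "prev w i < string_end w q" using p by simp
          then have "Suc (prev w i) < N" using E(2) by simp
          then have "i = Suc (prev w i)"
            using succ_prev[of i] A by (simp add: succ_def N_def[symmetric])
          then have "w ! i = w ! q" using p lt by (intro E(4)) auto
          then show False using False qc by simp
        qed
        then have "i = succ w (string_end w q)" using succ_prev[of i] A by simp
        then show ?thesis by (simp add: succ_def N_def)
      qed
    next
      assume ?B
      then show ?A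
      proof
        assume i: "i = Suc (string_end w q) mod N"
        then have "i < N" using nonempty by simp
        moreover have "start_of w (string_end w q) = q"
          using start_of_eq_iff[OF assms E(2)] True E(1) by simp
        ultimately show ?thesis
          using next_start[OF assms] qc i by (simp add: corner_edge_def)
      next
        assume i: "q \<le> i \<and> i \<le> string_end w q"
        then have "w ! i = c" using E(4)[of i] qc by simp
        with i show ?thesis
          using E(1,2) True start_of_eq_iff[OF assms, of i] qc by (auto simp: corner_edge_def)
      qed
    qed
    then have "{i. i < N \<and> corner_edge w c i = q} = insert (Suc (string_end w q) mod N) {q..string_end w q}"
      unfolding set_eq_iff mem_Collect_eq insert_iff atLeastAtMost_iff by blast
    then show ?thesis using True qc by simp
  next
    case qc: False
    have False if i: "i < N" "corner_edge w c i = q" for i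
    proof (cases "w ! i = c")
      case wi: True
      then show False using i qc letter_start_of[OF i(1)] by (simp add: corner_edge_def)
    next
      case wi: False
      then have si: "string_start w i" using i True by (auto simp: corner_edge_def split: if_splits)
      then have "w ! q = w ! prev w i"
        using i wi letter_start_of[OF prev_less[OF i(1)]] by (simp add: corner_edge_def)
      moreover have "w ! prev w i \<noteq> w ! i" using si string_start_iff[OF i(1)] by simp
      ultimately show False using wi qc two_letters[of c "w ! i" "w ! q"] by auto
    qed
    then show ?thesis using True qc by auto
  qed
next
  case False
  have "i < N \<and> corner_edge w c i = q \<longleftrightarrow> i = q \<and> w ! q \<noteq> c" for i
    using False start_of_props(2)[of i] start_of_props(2)[of "prev w i"] assms
    by (auto simp: corner_edge_def)
  then show ?thesis using False by auto
qed

lemma edge_sum_eq: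
  fixes f :: "corner \<Rightarrow> nat \<Rightarrow> 'm::comm_monoid_add"
  assumes q: "q < N"
  shows "edge_sum w f q = f ZCorner (prev w q) + f ZCorner (succ w (fan_end w q)) +
    (\<Sum>c\<in>{R, L}. \<Sum>i | i < N \<and> corner_edge w c i = q. f (Corner c) i + f (Corner c) i)"
proof (cases "string_start w q")
  case True
  note E = string_end_props[OF q]
  define k where "k = string_end w q"
  have list: "(\<Sum>(\<kappa>, i)\<leftarrow>concat (map (\<lambda>i. [(Corner c, i mod N), (Corner c, i mod N)]) xs). f \<kappa> i)
      = (\<Sum>i\<leftarrow>xs. f (Corner c) (i mod N) + f (Corner c) (i mod N))" for c xs
    by (induction xs) (auto simp: add.assoc)
  \<comment> \<open>The fan does not close up on itself, as the letter after the string is a different one.\<close>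
  have new: "Suc k mod N \<notin> {q..k}"
  proof
    assume "Suc k mod N \<in> {q..k}"
    then have "w ! (Suc k mod N) = w ! q" by (intro E(4)) (auto simp: k_def)
    then show False using next_start(2)[OF q] by (simp add: k_def)
  qed
  have "(\<Sum>i\<leftarrow>[q..<k + 2]. f (Corner c) (i mod N) + f (Corner c) (i mod N))
      = (\<Sum>i\<in>insert (Suc k mod N) {q..k}. f (Corner c) i + f (Corner c) i)" for c
  proof -
    have "[q..<k + 2] = [q..<Suc k] @ [Suc k]" using E(1) by (simp add: k_def)
    moreover have "(\<Sum>i\<leftarrow>[q..<Suc k]. f (Corner c) (i mod N) + f (Corner c) (i mod N))
        = (\<Sum>i\<in>{q..k}. f (Corner c) i + f (Corner c) i)"
      unfolding sum_set_upt_conv_sum_list_nat[symmetric]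
      using E(2) by (intro sum.cong) (auto simp: k_def)
    ultimately show ?thesis using new by (simp add: add.commute)
  qed
  moreover have "(k + 2) mod N = succ w (fan_end w q)"
    using True by (simp add: succ_def fan_end_def k_def N_def mod_Suc_eq)
  ultimately have "edge_sum w f q = f ZCorner (prev w q) + ((\<Sum>i\<in>insert (Suc k mod N) {q..k}.
      f (Corner (w ! q)) i + f (Corner (w ! q)) i) + f ZCorner (succ w (fan_end w q)))"
    using True unfolding edge_sum_def edge_corners_def Let_def N_def[symmetric] k_def[symmetric]
    by (simp add: list del: upt_Suc)
  then show ?thesis
    unfolding corner_edge_fibre[OF q] k_def using True by (cases "w ! q") (simp_all add: ac_simps)
next
  case False
  then show ?thesis
    unfolding corner_edge_fibre[OF q] using q
    by (cases "w ! q") (simp_all add: edge_sum_def edge_corners_def fan_end_def other_letter_def N_def[symmetric] ac_simps)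
qed

lemma bij_prev: "bij_betw (prev w) {..<N} {..<N}"
  by (rule bij_betw_byWitness[of _ "succ w"])
    (auto simp: prev_less succ_less succ_prev prev_succ)

lemma bij_succ: "bij_betw (succ w) {..<N} {..<N}"
  by (rule bij_betw_byWitness[of _ "prev w"])
    (auto simp: prev_less succ_less succ_prev prev_succ)

text \<open>The starts of strings are permuted cyclically, and every other position is fixed.\<close>

lemma bij_fan_end: "bij_betw (fan_end w) {..<N} {..<N}"
proof -
  have prev_next_start: "prev w (fan_end w r) = string_end w r" if "r < N" "string_start w r" for r
    using next_start(3)[OF that(1)] that(2) by (simp add: fan_end_def N_def)
  have "inj_on (fan_end w) {..<N}"
  proof (rule inj_onI)
    fix p q assume pq: "p \<in> {..<N}" "q \<in> {..<N}" "fan_end w p = fan_end w q"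
    have starts: "string_start w p \<longleftrightarrow> string_start w q"
      using pq next_start(1) by (auto simp: fan_end_def N_def[symmetric] split: if_splits)
    show "p = q"
    proof (cases "string_start w p")
      case True
      then have "string_end w p = string_end w q"
        using prev_next_start[of p] prev_next_start[of q] pq starts by simp
      moreover have "start_of w (string_end w r) = r" if "r < N" "string_start w r" for r
        using start_of_eq_iff[OF that(1), of "string_end w r"] string_end_props(1,2)[OF that(1)] that(2) by simp
      ultimately show ?thesis using pq starts True by (metis lessThan_iff)
    qed (use pq starts in \<open>simp add: fan_end_def\<close>)
  qed
  moreover have "fan_end w ` {..<N} \<subseteq> {..<N}"
    using nonempty by (auto simp: fan_end_def N_def)
  ultimately show ?thesis
    by (simp add: bij_betw_def endo_inj_surj)
qed

text \<open>Double counting of the corners: each tetrahedron has two of each kind.\<close>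

lemma sum_of_edge_sums:
  fixes f :: "corner \<Rightarrow> nat \<Rightarrow> 'm::comm_monoid_add"
  shows "(\<Sum>q<N. edge_sum w f q) = (\<Sum>i<N. (f ZCorner i + f (Corner R) i + f (Corner L) i)
    + (f ZCorner i + f (Corner R) i + f (Corner L) i))"
proof -
  have regroup: "(\<Sum>q<N. \<Sum>i | i < N \<and> corner_edge w c i = q. g i) = (\<Sum>i<N. g i)"
    for c and g :: "nat \<Rightarrow> 'm"
    using sum.group[of "{..<N}" "{..<N}" "corner_edge w c" g] corner_edge_less by auto
  have "(\<Sum>q<N. edge_sum w f q) = (\<Sum>q<N. f ZCorner (prev w q)) + (\<Sum>q<N. f ZCorner (succ w (fan_end w q)))
      + (\<Sum>i<N. f (Corner R) i + f (Corner R) i) + (\<Sum>i<N. f (Corner L) i + f (Corner L) i)"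
    by (simp add: edge_sum_eq sum.distrib regroup ac_simps)
  also have "(\<Sum>q<N. f ZCorner (prev w q)) = (\<Sum>i<N. f ZCorner i)"
    by (rule sum.reindex_bij_betw[OF bij_prev])
  also have "(\<Sum>q<N. f ZCorner (succ w (fan_end w q))) = (\<Sum>i<N. f ZCorner i)"
    using sum.reindex_bij_betw[OF bij_betw_trans[OF bij_fan_end bij_succ], of "f ZCorner"] by simp
  finally show ?thesis by (simp add: sum.distrib ac_simps)
qed

text \<open>If the edge \<open>i\<close> itself sees the corner, it meets the preceding tetrahedron in a \<open>ZCorner\<close>. Otherwise
  tetrahedron \<open>i\<close> is not the first one of its fan, and the preceding tetrahedron belongs to the same
  fan.\<close>

lemma corner_edge_meets_prev:
  assumes i: "i < N"
  shows "corner_edge w c i = i \<or> (\<exists>d. corner_edge w d (prev w i) = corner_edge w c i)"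
proof (cases "w ! i = c")
  case True
  show ?thesis
  proof (cases "string_start w i")
    case si: True
    then have "start_of w i = i"
      using start_of_eq_iff[OF i i] string_end_props(1)[OF i] by simp
    then show ?thesis using True by (simp add: corner_edge_def)
  next
    case si: False
    then have ne: "start_of w i \<noteq> i" using start_of_props(2)[of i] by auto
    have "0 < i" using si by (auto simp: string_start_def)
    then have p: "prev w i = i - 1" using i by (simp add: prev_eq)
    have s: "string_start w (start_of w i)" "start_of w i \<le> i" "i \<le> string_end w (start_of w i)"
      using start_of_eq_iff[OF start_of_less[OF i] i] by auto
    have "start_of w (prev w i) = start_of w i"
      using start_of_eq_iff[OF start_of_less[OF i], of "prev w i"] s ne i p by auto
    moreover have "w ! prev w i = c" using si string_start_iff[OF i] True by simp
    ultimately show ?thesis using True by (auto simp: corner_edge_def)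
  qed
next
  case False
  show ?thesis
  proof (cases "string_start w i")
    case True
    then have "w ! prev w i = c"
      using string_start_iff[OF i] False two_letters by metis
    then show ?thesis using False True by (auto simp: corner_edge_def)
  qed (use False in \<open>simp add: corner_edge_def\<close>)
qed

end

lemma RL_word_cyclic: "RL_word w \<Longrightarrow> cyclic_word w"
proof -
  assume "RL_word w"
  then obtain ps where ps: "ps \<noteq> []" "\<forall>(m, n)\<in>set ps. m \<ge> 1 \<and> n \<ge> 1"
    and w: "w = concat (map (\<lambda>(m, n). replicate m R @ replicate n L) ps)"
    unfolding RL_word_def by blast
  obtain m n qs where hd: "ps = (m, n) # qs" using ps(1) by (cases ps) auto
  obtain m' n' rs where last: "ps = rs @ [(m', n')]" using ps(1) by (cases ps rule: rev_cases) auto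
  have "1 \<le> m" using ps(2) hd by auto
  have "1 \<le> n'" using ps(2) unfolding last by auto
  then have first: "w ! 0 = R" "w \<noteq> []"
    unfolding w hd using \<open>1 \<le> m\<close> by (auto simp: nth_append)
  have "last w = L" unfolding w last using \<open>1 \<le> n'\<close> by simp
  then show ?thesis
    using first by unfold_locales (auto simp: last_conv_nth)
qed

section \<open>Logarithms of the corners near a real solution\<close>

text \<open>The logarithmic derivative, at the parameter \<open>a\<close>, of the factor carried by the corner.\<close>

definition slope :: "real \<Rightarrow> corner \<Rightarrow> real" where
  "slope a \<kappa> = (case \<kappa> of ZCorner \<Rightarrow> 1 / a
     | Corner R \<Rightarrow> - 1 / (1 - a) - 1 / a | Corner L \<Rightarrow> 1 / (1 - a))"

lemma slope_sum: "slope a ZCorner + slope a (Corner R) + slope a (Corner L) = 0"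
  by (simp add: slope_def)

text \<open>For positive \<open>a\<close> the sign of each factor agrees with the sign of its logarithmic derivative, and
  exactly one of the three factors is negative.\<close>

lemma shape_sign:
  assumes "0 < a" "a \<noteq> (1::real)"
  shows "shape \<kappa> a < 0 \<longleftrightarrow> slope a \<kappa> < 0" "shape \<kappa> a < 0 \<longleftrightarrow> \<kappa> = Corner (if a < 1 then R else L)"
    "slope a \<kappa> \<noteq> 0"
proof -
  have R: "slope a (Corner R) = - 1 / (a * (1 - a))"
    using assms by (simp add: slope_def field_simps)
  have "(shape \<kappa> a < 0 \<longleftrightarrow> slope a \<kappa> < 0) \<and> (shape \<kappa> a < 0 \<longleftrightarrow> \<kappa> = Corner (if a < 1 then R else L))
      \<and> slope a \<kappa> \<noteq> 0"
  proof (cases \<kappa>)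
    case ZCorner
    then show ?thesis using assms by (auto simp: slope_def)
  next
    case (Corner c)
    then show ?thesis
      using assms R by (cases c) (auto simp: shape_x_def shape_y_def slope_def divide_less_0_iff
        zero_less_mult_iff mult_less_0_iff)
  qed
  then show "shape \<kappa> a < 0 \<longleftrightarrow> slope a \<kappa> < 0" "shape \<kappa> a < 0 \<longleftrightarrow> \<kappa> = Corner (if a < 1 then R else L)"
    "slope a \<kappa> \<noteq> 0" by auto
qed

lemma norm_scaled_less_one:
  fixes d :: "'k::real_normed_field"
  assumes "norm d < \<bar>c\<bar>"
  shows "norm (of_real (1 / c) * d) < 1"
proof -
  have "norm (of_real (1 / c) * d) = norm d / \<bar>c\<bar>"
    by (simp add: norm_mult norm_divide)
  also have "\<dots> < 1" using assms norm_ge_zero[of d] by (simp add: divide_less_eq)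
  finally show ?thesis .
qed

text \<open>A logarithm near \<open>1\<close>, written as a function of the distance to \<open>1\<close>. It allows the real and the
  complex numbers to be treated together.\<close>

locale log_near_one =
  fixes lg :: "'k::{real_normed_field, banach} \<Rightarrow> 'k"
  assumes deriv_lg: "\<And>d. norm d < 1 \<Longrightarrow> (lg has_field_derivative inverse (1 + d)) (at d)"
    and exp_lg: "\<And>d. norm d < 1 \<Longrightarrow> exp (lg d) = 1 + d"
    and lg_0: "lg 0 = 0"
begin

text \<open>The logarithm of the ratio of the factors at the parameters \<open>a + d\<close> and \<open>a\<close>, composed from those of
  \<open>z\<close> and of \<open>1 - z\<close>. As a combination of these two it satisfies the relation \<open>corner_log_sum\<close> for
  all \<open>d\<close>, without choices of branches.\<close>

definition corner_log :: "real \<Rightarrow> corner \<Rightarrow> 'k \<Rightarrow> 'k" where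
  "corner_log a \<kappa> d = (case \<kappa> of ZCorner \<Rightarrow> lg (of_real (1 / a) * d)
     | Corner R \<Rightarrow> lg (of_real (- 1 / (1 - a)) * d) + - lg (of_real (1 / a) * d)
     | Corner L \<Rightarrow> - lg (of_real (- 1 / (1 - a)) * d))"

lemma corner_log_sum: "corner_log a ZCorner d + corner_log a (Corner R) d + corner_log a (Corner L) d = 0"
  by (simp add: corner_log_def)

lemma exp_corner_log:
  assumes a: "a \<noteq> 0" "a \<noteq> 1" and d: "norm d < \<bar>a\<bar>" "norm d < \<bar>1 - a\<bar>"
  shows "shape \<kappa> (of_real a + d) = exp (corner_log a \<kappa> d) * of_real (shape \<kappa> a)"
proof -
  have nz: "of_real a \<noteq> (0::'k)" "1 - of_real a \<noteq> (0::'k)"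
    using a of_real_eq_iff[of 1 a, where 'a = 'k] by auto
  have "exp (lg (of_real (1 / a) * d)) = 1 + of_real (1 / a) * d"
    by (rule exp_lg[OF norm_scaled_less_one[OF d(1)]])
  also have "\<dots> = (of_real a + d) / of_real a" using nz by (simp add: add_divide_distrib)
  finally have e1: "exp (lg (of_real (1 / a) * d)) = (of_real a + d) / of_real a" .
  have m: "- 1 / (1 - a) = 1 / - (1 - a)" by (simp only: divide_minus_left divide_minus_right)
  have inv: "of_real (- 1 / (1 - a)) = - inverse (1 - of_real a :: 'k)"
    by (simp add: inverse_eq_divide)
  have "exp (lg (of_real (- 1 / (1 - a)) * d)) = 1 + of_real (- 1 / (1 - a)) * d"
    unfolding m using d(2) by (intro exp_lg norm_scaled_less_one) simp
  also have "\<dots> = (1 - (of_real a + d)) / (1 - of_real a)"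
    unfolding inv using nz by (simp add: divide_inverse left_diff_distrib) (simp add: field_simps)
  finally have e2: "exp (lg (of_real (- 1 / (1 - a)) * d)) = (1 - (of_real a + d)) / (1 - of_real a)" .
  note e = e1 e2
  have "of_real a + d \<noteq> 0" "1 - (of_real a + d) \<noteq> 0"
    using e by (metis div_0 exp_not_eq_zero)+
  then have nz': "of_real a + d \<noteq> 0" "1 - (of_real a + d) \<noteq> 0" .
  show ?thesis
  proof (cases \<kappa> rule: corner_letter_cases)
    case 1
    have "exp (corner_log a \<kappa> d) = (of_real a + d) / of_real a"
      by (simp only: 1 corner_log_def corner.case e)
    then show ?thesis using nz by (simp add: 1)
  next
    case 2
    have "exp (corner_log a \<kappa> d) = ((1 - (of_real a + d)) / (1 - of_real a)) / ((of_real a + d) / of_real a)"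
      by (simp only: 2 corner_log_def corner.case letter.case e exp_add exp_minus divide_inverse[symmetric])
    moreover have "shape \<kappa> (of_real a + d) = (((1 - (of_real a + d)) / (1 - of_real a)) / ((of_real a + d) / of_real a))
        * ((of_real a - 1) / of_real a)"
      using nz nz' by (simp add: 2 shape_x_def divide_simps) (simp add: algebra_simps)
    ultimately show ?thesis by (simp add: 2 shape_x_def)
  next
    case 3
    have "exp (corner_log a \<kappa> d) = inverse ((1 - (of_real a + d)) / (1 - of_real a))"
      by (simp only: 3 corner_log_def corner.case letter.case e exp_minus)
    then show ?thesis using nz by (simp add: 3 shape_y_def)
  qed
qed

text \<open>The derivative of the remainder is \<open>1 / (1 + d) - 1\<close>, which is small near \<open>d = 0\<close>.\<close>

lemma lg_remainder:
  assumes "0 < \<epsilon>"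
  shows "\<exists>\<delta>>0. \<forall>x y. norm x \<le> \<delta> \<longrightarrow> norm y \<le> \<delta> \<longrightarrow> norm ((lg x - x) - (lg y - y)) \<le> \<epsilon> * norm (x - y)"
proof -
  have "((\<lambda>d::'k. inverse (1 + d) - 1) \<longlongrightarrow> inverse (1 + 0) - 1) (at 0)"
    by (intro tendsto_intros) auto
  then have "\<forall>\<^sub>F d in at 0. norm (inverse (1 + d) - 1 :: 'k) < \<epsilon>"
    using assms by (auto simp: tendsto_iff dist_norm)
  then obtain \<rho> where \<rho>: "0 < \<rho>" "\<And>d::'k. d \<noteq> 0 \<Longrightarrow> norm d < \<rho> \<Longrightarrow> norm (inverse (1 + d) - 1) < \<epsilon>"
    by (auto simp: eventually_at dist_norm)
  define \<delta> where "\<delta> = min (\<rho> / 2) (1 / 2)"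
  have \<delta>: "0 < \<delta>" "\<delta> < \<rho>" "\<delta> < 1" using \<rho>(1) by (auto simp: \<delta>_def)
  have "norm ((lg x - x) - (lg y - y)) \<le> \<epsilon> * norm (x - y)" if "norm x \<le> \<delta>" "norm y \<le> \<delta>" for x y
  proof (rule field_differentiable_bound[of "cball 0 \<delta>" "\<lambda>d. lg d - d"])
    show "((\<lambda>d. lg d - d) has_field_derivative inverse (1 + d) - 1) (at d within cball 0 \<delta>)"
      if "d \<in> cball 0 \<delta>" for d
      using that \<delta> by (intro DERIV_diff DERIV_ident has_field_derivative_at_within[OF deriv_lg]) auto
    show "norm (inverse (1 + d) - 1) \<le> \<epsilon>" if "d \<in> cball 0 \<delta>" for d :: 'k
      using \<rho>(2)[of d] that \<delta> assms by (cases "d = 0") auto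
  qed (use that in auto)
  then show ?thesis using \<delta>(1) by blast
qed

lemma flat_corner_log:
  assumes "i < n"
  shows "flat_at_zero n (\<lambda>x. corner_log a \<kappa> (x i) - slope a \<kappa> *\<^sub>R x i)"
proof -
  have flat: "flat_at_zero n (\<lambda>x. lg (of_real c * x i) - of_real c * x i)" for c
    by (rule flat_at_zero_coordinate[of "\<lambda>d. lg d - d"]) (use lg_0 assms lg_remainder in auto)
  show ?thesis
  proof (cases \<kappa> rule: corner_letter_cases)
    case 1
    then show ?thesis
      using flat[of "1 / a"] by (simp add: corner_log_def slope_def scaleR_conv_of_real)
  next
    case 2
    have "(\<lambda>x. corner_log a \<kappa> (x i) - slope a \<kappa> *\<^sub>R x i) = (\<lambda>x.
        (lg (of_real (- 1 / (1 - a)) * x i) - of_real (- 1 / (1 - a)) * x i)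
        + - (lg (of_real (1 / a) * x i) - of_real (1 / a) * x i))"
      unfolding 2 corner_log_def slope_def corner.case letter.case scaleR_conv_of_real of_real_diff
      by (rule ext) (simp add: left_diff_distrib del: of_real_divide of_real_minus of_real_diff)
    then show ?thesis by (simp only: flat_at_zero_add flat_at_zero_uminus flat)
  next
    case 3
    have "(\<lambda>x. corner_log a \<kappa> (x i) - slope a \<kappa> *\<^sub>R x i)
        = (\<lambda>x. - (lg (of_real (- 1 / (1 - a)) * x i) - of_real (- 1 / (1 - a)) * x i))"
      by (rule ext) (simp add: 3 corner_log_def slope_def scaleR_conv_of_real)
    then show ?thesis by (simp only: flat_at_zero_uminus flat)
  qed
qed

end

lemma log_near_one_Ln: "log_near_one (\<lambda>d. Ln (1 + d))"
proof
  fix d :: complex assume "norm d < 1"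
  then have "0 < Re (1 + d)" using abs_Re_le_cmod[of d] by simp
  then have d: "1 + d \<notin> \<real>\<^sub>\<le>\<^sub>0" "1 + d \<noteq> 0"
    by (auto simp: complex_nonpos_Reals_iff complex_eq_iff)
  show "((\<lambda>d. Ln (1 + d)) has_field_derivative inverse (1 + d)) (at d)"
    using d(1) by (auto intro!: derivative_eq_intros simp: inverse_eq_divide)
  show "exp (Ln (1 + d)) = 1 + d" using d(2) by simp
qed simp

lemma log_near_one_ln: "log_near_one (\<lambda>d::real. ln (1 + d))"
proof
  fix d :: real assume "norm d < 1"
  then have d: "0 < 1 + d" by simp
  show "((\<lambda>d. ln (1 + d)) has_field_derivative inverse (1 + d)) (at d)"
    using d by (auto intro!: derivative_eq_intros simp: inverse_eq_divide)
  show "exp (ln (1 + d)) = 1 + d" using d by simp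
qed simp

section \<open>The Jacobian of the logarithmic edge holonomies\<close>

context cyclic_word
begin

lemma edge_corners_less: "(\<kappa>, i) \<in> set (edge_corners w q) \<Longrightarrow> i < N"
  using nonempty unfolding N_def
  by (auto simp: edge_corners_def Let_def prev_def succ_def simp del: upt_Suc split: if_splits)

text \<open>The derivative at \<open>F\<close> of the logarithm of the holonomy of edge \<open>q\<close> with respect to the parameter of
  tetrahedron \<open>i\<close>, which may have several corners at the edge.\<close>

definition jacobian :: "(nat \<Rightarrow> real) \<Rightarrow> nat \<Rightarrow> nat \<Rightarrow> real" where
  "jacobian F q i = edge_sum w (\<lambda>\<kappa> j. if j = i then slope (F j) \<kappa> else 0) q"

lemma edge_sum_cong:
  assumes "\<And>\<kappa> i. i < N \<Longrightarrow> f \<kappa> i = g \<kappa> i"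
  shows "edge_sum w f q = edge_sum w g q"
  unfolding edge_sum_def using assms edge_corners_less
  by (intro arg_cong[of _ _ sum_list] map_cong) auto

lemma jacobian_sum:
  fixes x :: "nat \<Rightarrow> 'a::real_vector"
  shows "(\<Sum>i<N. jacobian F q i *\<^sub>R x i) = edge_sum w (\<lambda>\<kappa> i. slope (F i) \<kappa> *\<^sub>R x i) q"
proof -
  have "(\<Sum>i<N. (\<Sum>(\<kappa>, j)\<leftarrow>ks. if j = i then slope (F j) \<kappa> else 0) *\<^sub>R x i)
      = (\<Sum>(\<kappa>, i)\<leftarrow>ks. slope (F i) \<kappa> *\<^sub>R x i)" if "\<forall>(\<kappa>, i)\<in>set ks. i < N" for ks
    using that
  proof (induction ks)
    case (Cons k ks)
    obtain \<kappa> j where k: "k = (\<kappa>, j)" by (cases k)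
    have "(\<Sum>i<N. (if j = i then slope (F j) \<kappa> else 0) *\<^sub>R x i)
        = (\<Sum>i<N. if i = j then slope (F j) \<kappa> *\<^sub>R x j else 0)"
      by (intro sum.cong) auto
    also have "\<dots> = slope (F j) \<kappa> *\<^sub>R x j"
      using Cons.prems k by simp
    finally show ?case
      using Cons k by (simp add: scaleR_left_distrib sum.distrib)
  qed simp
  then show ?thesis
    unfolding jacobian_def edge_sum_def using edge_corners_less by blast
qed

text \<open>The infinitesimal form of the relation \<open>x y z = -1\<close> in each tetrahedron.\<close>

lemma jacobian_column_sum:
  assumes "i < N"
  shows "(\<Sum>q<N. jacobian F q i) = 0"
proof -
  have "(if j = i then slope (F j) ZCorner else 0) + (if j = i then slope (F j) (Corner R) else 0)
      + (if j = i then slope (F j) (Corner L) else 0) = 0" for j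
    using slope_sum[of "F j"] by auto
  then show ?thesis unfolding jacobian_def sum_of_edge_sums by simp
qed

lemma jacobian_eq:
  assumes "q < N" "i < N"
  shows "jacobian F q i = (if prev w q = i then slope (F i) ZCorner else 0)
    + (if succ w (fan_end w q) = i then slope (F i) ZCorner else 0)
    + (\<Sum>c\<in>{R, L}. if corner_edge w c i = q then 2 * slope (F i) (Corner c) else 0)"
proof -
  have "(\<Sum>j | j < N \<and> corner_edge w c j = q. (if j = i then slope (F j) (Corner c) else 0)
      + (if j = i then slope (F j) (Corner c) else 0))
      = (\<Sum>j | j < N \<and> corner_edge w c j = q. if j = i then 2 * slope (F i) (Corner c) else 0)" for c
    by (intro sum.cong) auto
  also have "\<dots> c = (if corner_edge w c i = q then 2 * slope (F i) (Corner c) else 0)" for c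
    using assms(2) by simp
  finally show ?thesis
    unfolding jacobian_def edge_sum_eq[OF assms(1)] by (auto simp del: sum.insert)
qed

text \<open>The tangent directions at \<open>F\<close> to the real solutions form a line, and they can be chosen to increase
  all parameters simultaneously.\<close>

definition positive_kernel :: "(nat \<Rightarrow> real) \<Rightarrow> (nat \<Rightarrow> real) \<Rightarrow> bool" where
  "positive_kernel F v \<longleftrightarrow> (\<forall>i<N. 0 < v i) \<and> (\<forall>q<N. (\<Sum>i<N. jacobian F q i * v i) = 0) \<and>
     (\<forall>u. (\<forall>q<N. (\<Sum>i<N. jacobian F q i * u i) = 0) \<longrightarrow> (\<exists>t. \<forall>i<N. u i = t * v i))"

text \<open>The kind of the corners of tetrahedron \<open>i\<close> whose factor is negative: \<open>x < 0\<close> for \<open>0 < z < 1\<close> and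
  \<open>y < 0\<close> for \<open>z > 1\<close>.\<close>

definition negative_letter :: "(nat \<Rightarrow> real) \<Rightarrow> nat \<Rightarrow> letter" where
  "negative_letter F i = (if F i < 1 then R else L)"

definition negative_edge :: "(nat \<Rightarrow> real) \<Rightarrow> nat \<Rightarrow> nat" where
  "negative_edge F i = corner_edge w (negative_letter F i) i"

context
  fixes F :: "nat \<Rightarrow> real"
  assumes F: "F \<in> V_plus w"
begin

lemma F_pos: "i < N \<Longrightarrow> 0 < F i" and F_neq_1: "i < N \<Longrightarrow> F i \<noteq> 1"
  and F_edge: "q < N \<Longrightarrow> prod_list (edge_factors w F q) = 1"
  and F_negative: "q < N \<Longrightarrow> length (filter (\<lambda>f. f < 0) (edge_factors w F q)) = 2"
  using F by (auto simp: V_plus_def real_solution_def edge_equations_def edge_holonomy_def N_def)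

lemma count_negative_factors:
  "length (filter (\<lambda>f. f < 0) (edge_factors w F q))
    = edge_sum w (\<lambda>\<kappa> i. if shape \<kappa> (F i) < 0 then 1 else 0) q"
proof -
  have "length (filter (\<lambda>f. f < 0) (map (\<lambda>(\<kappa>, i). shape \<kappa> (F i)) ks))
      = (\<Sum>(\<kappa>, i)\<leftarrow>ks. if shape \<kappa> (F i) < 0 then 1 else 0)" for ks
    by (induction ks) auto
  then show ?thesis by (simp add: edge_factors_eq edge_sum_def)
qed

text \<open>Corners with negative factors come in pairs at the same edge, so the two negative factors of an edge
  belong to a single tetrahedron.\<close>

lemma one_negative_corner:
  assumes "q < N"
  shows "card {i. i < N \<and> negative_edge F i = q} = 1"
proof -
  let ?n = "\<lambda>c i. if shape (Corner c) (F i) < 0 then 1 else 0 :: nat"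
  have Z: "\<not> shape ZCorner (F i) < 0" if "i < N" for i
    using F_pos[OF that] by simp
  have "(\<Sum>i | i < N \<and> corner_edge w c i = q. ?n c i + ?n c i)
      = (\<Sum>i<N. if corner_edge w c i = q \<and> negative_letter F i = c then 2 else 0)" for c
  proof -
    have "(\<Sum>i | i < N \<and> corner_edge w c i = q. ?n c i + ?n c i)
        = (\<Sum>i\<in>{i \<in> {..<N}. corner_edge w c i = q}. ?n c i + ?n c i)"
      by (intro sum.cong) auto
    also have "\<dots> = (\<Sum>i<N. if corner_edge w c i = q then ?n c i + ?n c i else 0)"
      by (rule sum.inter_filter) simp
    also have "\<dots> = (\<Sum>i<N. if corner_edge w c i = q \<and> negative_letter F i = c then 2 else 0)"
      using shape_sign(2)[OF F_pos F_neq_1, where \<kappa> = "Corner c"]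
      by (intro sum.cong) (auto simp: negative_letter_def)
    finally show ?thesis .
  qed
  then have "2 = (\<Sum>i<N. if corner_edge w R i = q \<and> negative_letter F i = R then 2 else 0)
      + (\<Sum>i<N. if corner_edge w L i = q \<and> negative_letter F i = L then 2 else (0::nat))"
    using F_negative[OF assms] Z[OF prev_less[OF assms]] Z[OF succ_less]
    unfolding count_negative_factors edge_sum_eq[OF assms] by simp
  also have "\<dots> = (\<Sum>i<N. if negative_edge F i = q then 2 else 0)"
    unfolding sum.distrib[symmetric] negative_edge_def
    by (intro sum.cong refl) (auto simp: negative_letter_def)
  also have "\<dots> = (\<Sum>i\<in>{i \<in> {..<N}. negative_edge F i = q}. 2)"
    by (rule sum.inter_filter[symmetric]) simp
  finally show ?thesis by simp
qed

lemma bij_negative_edge: "bij_betw (negative_edge F) {..<N} {..<N}"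
proof -
  have range: "negative_edge F ` {..<N} \<subseteq> {..<N}"
    using corner_edge_less by (auto simp: negative_edge_def)
  have "inj_on (negative_edge F) {..<N}"
  proof (rule inj_onI)
    fix i j assume ij: "i \<in> {..<N}" "j \<in> {..<N}" "negative_edge F i = negative_edge F j"
    then have "card {k. k < N \<and> negative_edge F k = negative_edge F j} = 1"
      using range by (intro one_negative_corner) auto
    then obtain k where k: "{k. k < N \<and> negative_edge F k = negative_edge F j} = {k}"
      by (rule card_1_singletonE)
    have "i \<in> {k}" "j \<in> {k}" unfolding k[symmetric] using ij by auto
    then show "i = j" by simp
  qed
  then show ?thesis using range by (simp add: bij_betw_def endo_inj_surj)
qed

lemma slope_pos:
  assumes "i < N" "\<kappa> \<noteq> Corner (negative_letter F i)"
  shows "0 < slope (F i) \<kappa>"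
  using shape_sign[OF F_pos F_neq_1, OF assms(1) assms(1), of \<kappa>] assms(2)
  by (auto simp: negative_letter_def)

lemma jacobian_nonneg:
  assumes "q < N" "i < N" "negative_edge F i \<noteq> q"
  shows "0 \<le> jacobian F q i"
  unfolding jacobian_eq[OF assms(1,2)] using assms(2,3)
  by (intro add_nonneg_nonneg sum_nonneg)
    (auto simp: negative_edge_def intro!: less_imp_le[OF slope_pos])

text \<open>The edge meets the preceding tetrahedron, and not in its negative corners, since those lie at a
  different edge.\<close>

lemma jacobian_pos_prev:
  assumes "i < N"
  shows "0 < jacobian F (negative_edge F i) (prev w i)"
proof -
  let ?q = "negative_edge F i" and ?p = "prev w i"
  have p: "?p < N" using prev_less[OF assms] .
  have q: "?q < N" using bij_negative_edge assms by (auto simp: bij_betw_def)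
  have "negative_edge F ?p \<noteq> ?q"
    using bij_negative_edge assms p prev_neq[OF assms] by (auto simp: bij_betw_def inj_on_def)
  then have nonneg: "0 \<le> (if corner_edge w c ?p = ?q then 2 * slope (F ?p) (Corner c) else 0)" for c
    using p by (auto simp: negative_edge_def intro!: less_imp_le[OF slope_pos])
  have Z: "0 < slope (F ?p) ZCorner" using slope_pos[OF p] by simp
  show ?thesis
  proof (cases "?q = i")
    case True
    then show ?thesis
      unfolding jacobian_eq[OF q p] using Z nonneg by (intro add_pos_nonneg sum_nonneg) auto
  next
    case False
    then obtain d where d: "corner_edge w d ?p = ?q"
      using corner_edge_meets_prev[OF assms, of "negative_letter F i"] by (auto simp: negative_edge_def)
    then have "0 < slope (F ?p) (Corner d)"
      using \<open>negative_edge F ?p \<noteq> ?q\<close> by (intro slope_pos[OF p]) (auto simp: negative_edge_def)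
    then have "0 < (\<Sum>c\<in>{R, L}. if corner_edge w c ?p = ?q then 2 * slope (F ?p) (Corner c) else 0)"
      using d nonneg by (intro sum_pos2[of _ d]) (cases d; auto)+
    then show ?thesis
      unfolding jacobian_eq[OF q p] using Z by (intro add_nonneg_pos) auto
  qed
qed

lemma positive_kernel_exists:
  obtains v where "positive_kernel F v"
proof -
  have r_less: "negative_edge F c < N" if "c < N" for c
    using bij_negative_edge that by (auto simp: bij_betw_def)
  have r_surj: "\<exists>c<N. q = negative_edge F c" if "q < N" for q
    using bij_negative_edge that by (auto simp: bij_betw_def image_iff set_eq_iff)
  obtain v where v: "\<And>i. i < N \<Longrightarrow> 0 < v i"
    "\<And>c. c < N \<Longrightarrow> (\<Sum>i<N. jacobian F (negative_edge F c) i * v i) = 0"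
    "\<And>u. (\<And>c. c < N \<Longrightarrow> (\<Sum>i<N. jacobian F (negative_edge F c) i * u i) = 0) \<Longrightarrow> \<exists>t. \<forall>i<N. u i = t * v i"
  proof (rule kernel_spanned_by_positive_vector[of N "\<lambda>c. jacobian F (negative_edge F c)"])
    fix c i assume ci: "c < N" "i < N" "c \<noteq> i"
    then have "negative_edge F i \<noteq> negative_edge F c"
      using bij_negative_edge by (auto simp: bij_betw_def inj_on_def)
    then show "0 \<le> jacobian F (negative_edge F c) i"
      using jacobian_nonneg r_less ci by simp
  next
    fix i assume "i < N"
    then show "(\<Sum>c<N. jacobian F (negative_edge F c) i) = 0"
      using sum.reindex_bij_betw[OF bij_negative_edge, of "\<lambda>q. jacobian F q i"] jacobian_column_sum by simp
  next
    fix c assume "c < N"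
    then show "0 < jacobian F (negative_edge F c) ((c + N - 1) mod N)"
      using jacobian_pos_prev[of c] by (simp add: prev_def N_def)
  qed (use N_ge_2 that in auto)
  show ?thesis
  proof (rule that[of v], unfold positive_kernel_def, intro conjI allI impI)
    show "0 < v i" if "i < N" for i by (rule v(1)[OF that])
    show "(\<Sum>i<N. jacobian F q i * v i) = 0" if "q < N" for q
      using r_surj[OF that] v(2) by auto
    show "\<exists>t. \<forall>i<N. u i = t * v i" if "\<forall>q<N. (\<Sum>i<N. jacobian F q i * u i) = 0" for u
      using v(3) that r_less by blast
  qed
qed

end

end

section \<open>Curves of solutions through a positive real solution\<close>

lemma flat_at_zero_sum_list:
  assumes "0 < n" "\<And>k. k \<in> set ks \<Longrightarrow> flat_at_zero n (g k)"
  shows "flat_at_zero n (\<lambda>x. \<Sum>k\<leftarrow>ks. g k x)"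
  using assms(2) by (induction ks) (simp_all add: flat_at_zero_zero[OF assms(1)] flat_at_zero_add)

lemma edge_sum_add: "edge_sum w f q + edge_sum w g q = edge_sum w (\<lambda>\<kappa> i. f \<kappa> i + g \<kappa> i) q"
  unfolding edge_sum_def sum_list_addf[symmetric]
  by (intro arg_cong[of _ _ sum_list] map_cong) auto

context cyclic_word
begin

lemma edge_holonomy_exp:
  fixes z :: "nat \<Rightarrow> 'k::{real_normed_field, banach}"
  assumes "\<And>\<kappa> i. i < N \<Longrightarrow> shape \<kappa> (z i) = exp (l \<kappa> i) * of_real (shape \<kappa> (F i))"
  shows "edge_holonomy w z q = exp (edge_sum w l q) * of_real (edge_holonomy w F q)"
proof -
  have "(\<Prod>(\<kappa>, i)\<leftarrow>ks. shape \<kappa> (z i)) = exp (\<Sum>(\<kappa>, i)\<leftarrow>ks. l \<kappa> i) * of_real (\<Prod>(\<kappa>, i)\<leftarrow>ks. shape \<kappa> (F i))"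
    if "\<forall>(\<kappa>, i)\<in>set ks. i < N" for ks
    using that assms by (induction ks) (auto simp: exp_add)
  then show ?thesis
    unfolding edge_holonomy_def edge_factors_eq edge_sum_def using edge_corners_less by blast
qed

text \<open>The unknowns are the deviations \<open>z\<^sub>i - F\<^sub>i\<close>, and the equations are the vanishing of the logarithms of
  the edge holonomies, with linear part the Jacobian. Their sum vanishes identically, by
  \<open>corner_log_sum\<close>. The bounds on the deviation keep every parameter on the same side of \<open>0\<close> and
  \<open>1\<close> as \<open>F\<^sub>i\<close> and within reach of the logarithms.\<close>

lemma solution_curve:
  fixes lg :: "'k \<Rightarrow> 'k::{real_normed_field, banach}"
  assumes F: "F \<in> V_plus w" and lg: "log_near_one lg"
    and v: "positive_kernel F v"
  obtains \<delta> :: real and Z :: "'k \<Rightarrow> nat \<Rightarrow> 'k" where "0 < \<delta>"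
    "\<And>i. continuous_on (ball 0 \<delta>) (\<lambda>s. Z s i)" "\<And>i. Z 0 i = of_real (F i)"
    "\<And>s i. norm s < \<delta> \<Longrightarrow> i < N \<Longrightarrow> \<exists>\<theta>. Z s i = of_real (F i) + s * (of_real (v i) + \<theta>) \<and> norm \<theta> < v i"
    "\<And>s i. norm s < \<delta> \<Longrightarrow> i < N \<Longrightarrow> norm (Z s i - of_real (F i)) < \<bar>F i\<bar>"
    "\<And>s i. norm s < \<delta> \<Longrightarrow> i < N \<Longrightarrow> norm (Z s i - of_real (F i)) < \<bar>1 - F i\<bar>"
    "\<And>s q. norm s < \<delta> \<Longrightarrow> q < N \<Longrightarrow>
      edge_sum w (\<lambda>\<kappa> i. log_near_one.corner_log lg (F i) \<kappa> (Z s i - of_real (F i))) q = 0"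
    "\<And>s q. norm s < \<delta> \<Longrightarrow> q < N \<Longrightarrow> edge_holonomy w (Z s) q = 1"
proof -
  interpret log_near_one lg by (rule lg)
  have v_pos: "\<And>i. i < N \<Longrightarrow> 0 < v i"
    and v_ker: "\<And>q. q < N \<Longrightarrow> (\<Sum>i<N. jacobian F q i * v i) = 0"
    and kernel: "\<And>u. (\<And>q. q < N \<Longrightarrow> (\<Sum>i<N. jacobian F q i * u i) = 0) \<Longrightarrow> \<exists>t. \<forall>i<N. u i = t * v i"
    using v by (simp_all add: positive_kernel_def)
  define G where "G q x = edge_sum w (\<lambda>\<kappa> i. corner_log (F i) \<kappa> (x i) - slope (F i) \<kappa> *\<^sub>R x i) q"
    for q and x :: "nat \<Rightarrow> 'k"
  have flat: "flat_at_zero N (G q)" for q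
    unfolding G_def edge_sum_def case_prod_beta
    using nonempty edge_corners_less by (intro flat_at_zero_sum_list flat_corner_log) auto
  have redundant: "(\<Sum>q<N. G q x) = 0" for x
  proof -
    have "(corner_log a ZCorner d - slope a ZCorner *\<^sub>R d)
        + (corner_log a (Corner R) d - slope a (Corner R) *\<^sub>R d)
        + (corner_log a (Corner L) d - slope a (Corner L) *\<^sub>R d)
        = (corner_log a ZCorner d + corner_log a (Corner R) d + corner_log a (Corner L) d)
        - (slope a ZCorner + slope a (Corner R) + slope a (Corner L)) *\<^sub>R d" for a d
      by (simp add: scaleR_left_distrib)
    then show ?thesis
      unfolding G_def sum_of_edge_sums by (simp add: corner_log_sum slope_sum)
  qed
  obtain \<delta>\<^sub>0 U where \<delta>\<^sub>0: "0 < \<delta>\<^sub>0"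
    and U: "\<And>i. continuous_on (ball 0 \<delta>\<^sub>0) (\<lambda>s. U s i)" "\<And>i. U 0 i = 0"
    and solves: "\<And>s q. norm s < \<delta>\<^sub>0 \<Longrightarrow> q < N \<Longrightarrow>
      (\<Sum>i<N. jacobian F q i *\<^sub>R (s * (of_real (v i) + U s i))) + G q (\<lambda>i. s * (of_real (v i) + U s i)) = 0"
    using redundant_system_solution_curve[where M = "jacobian F" and G = G and n = N and v = v,
        OF nonempty flat redundant jacobian_column_sum v_pos v_ker kernel] by blast
  define D where "D s i = s * (of_real (v i) + U s i)" for s i
  have D_cont: "continuous_on (ball 0 \<delta>\<^sub>0) (\<lambda>s. D s i)" for i
    unfolding D_def using U(1) by (intro continuous_intros)
  have at_0: "((\<lambda>s. U s i) \<longlongrightarrow> 0) (nhds 0)" "((\<lambda>s. D s i) \<longlongrightarrow> 0) (nhds 0)" for i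
  proof -
    have "isCont (\<lambda>s. U s i) 0" "isCont (\<lambda>s. D s i) 0"
      using U(1)[of i] D_cont[of i] \<delta>\<^sub>0 by (auto simp: continuous_on_eq_continuous_at)
    moreover have "(g \<longlongrightarrow> 0) (nhds 0)" if "isCont g 0" "g 0 = 0" for g :: "'k \<Rightarrow> 'k"
      using tendsto_at_iff_tendsto_nhds[of g 0] that by (simp add: isCont_def)
    ultimately show "((\<lambda>s. U s i) \<longlongrightarrow> 0) (nhds 0)" "((\<lambda>s. D s i) \<longlongrightarrow> 0) (nhds 0)"
      using U(2)[of i] by (simp_all add: D_def)
  qed
  have "\<forall>\<^sub>F s in nhds 0. \<forall>i\<in>{..<N}. norm (U s i) < v i \<and> norm (D s i) < \<bar>F i\<bar> \<and> norm (D s i) < \<bar>1 - F i\<bar>"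
  proof (intro eventually_ball_finite ballI eventually_conj)
    fix i assume "i \<in> {..<N}"
    then have pos: "0 < v i" "0 < \<bar>F i\<bar>" "0 < \<bar>1 - F i\<bar>"
      using v_pos F_pos[OF F, of i] F_neq_1[OF F, of i] by auto
    note small_U = order_tendstoD(2)[OF tendsto_norm_zero[OF at_0(1)]]
      and small_D = order_tendstoD(2)[OF tendsto_norm_zero[OF at_0(2)]]
    show "\<forall>\<^sub>F s in nhds 0. norm (U s i) < v i" by (rule small_U[OF pos(1)])
    show "\<forall>\<^sub>F s in nhds 0. norm (D s i) < \<bar>F i\<bar>" by (rule small_D[OF pos(2)])
    show "\<forall>\<^sub>F s in nhds 0. norm (D s i) < \<bar>1 - F i\<bar>" by (rule small_D[OF pos(3)])
  qed simp
  then obtain \<delta>\<^sub>1 where \<delta>\<^sub>1: "0 < \<delta>\<^sub>1" "\<And>s i. norm s < \<delta>\<^sub>1 \<Longrightarrow> i < N \<Longrightarrow>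
      norm (U s i) < v i \<and> norm (D s i) < \<bar>F i\<bar> \<and> norm (D s i) < \<bar>1 - F i\<bar>"
    by (auto simp: eventually_nhds_metric)
  define \<delta> where "\<delta> = min \<delta>\<^sub>0 \<delta>\<^sub>1"
  define Z where "Z s i = of_real (F i) + D s i" for s i
  have sum_0: "edge_sum w (\<lambda>\<kappa> i. corner_log (F i) \<kappa> (Z s i - of_real (F i))) q = 0"
    if "norm s < \<delta>" "q < N" for s q
  proof -
    have "(\<Sum>i<N. jacobian F q i *\<^sub>R D s i) + G q (D s)
        = edge_sum w (\<lambda>\<kappa> i. corner_log (F i) \<kappa> (D s i)) q"
      unfolding G_def jacobian_sum edge_sum_add by simp
    then show ?thesis using solves[of s q] that by (simp add: D_def[abs_def] Z_def \<delta>_def)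
  qed
  show ?thesis
  proof (rule that[of \<delta> Z])
    show "0 < \<delta>" using \<delta>\<^sub>0 \<delta>\<^sub>1 by (simp add: \<delta>_def)
    show "continuous_on (ball 0 \<delta>) (\<lambda>s. Z s i)" for i
      unfolding Z_def using D_cont[of i]
      by (intro continuous_intros) (auto simp: \<delta>_def elim: continuous_on_subset)
    show "Z 0 i = of_real (F i)" for i by (simp add: Z_def D_def)
    show "\<exists>\<theta>. Z s i = of_real (F i) + s * (of_real (v i) + \<theta>) \<and> norm \<theta> < v i"
      if "norm s < \<delta>" "i < N" for s i
      using \<delta>\<^sub>1(2)[of s i] that by (intro exI[of _ "U s i"]) (simp add: Z_def D_def \<delta>_def)
    show F_close: "norm (Z s i - of_real (F i)) < \<bar>F i\<bar>" "norm (Z s i - of_real (F i)) < \<bar>1 - F i\<bar>"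
      if "norm s < \<delta>" "i < N" for s i
      using \<delta>\<^sub>1(2)[of s i] that by (simp_all add: Z_def \<delta>_def)
    show "edge_sum w (\<lambda>\<kappa> i. corner_log (F i) \<kappa> (Z s i - of_real (F i))) q = 0"
      if "norm s < \<delta>" "q < N" for s q
      by (rule sum_0[OF that])
    show "edge_holonomy w (Z s) q = 1" if s: "norm s < \<delta>" "q < N" for s q
    proof -
      have "shape \<kappa> (Z s i) = exp (corner_log (F i) \<kappa> (Z s i - of_real (F i))) * of_real (shape \<kappa> (F i))"
        if "i < N" for \<kappa> i
        using exp_corner_log[of "F i" "Z s i - of_real (F i)" \<kappa>] F_close[OF s(1) that]
          F_pos[OF F that] F_neq_1[OF F that] by simp
      then have "edge_holonomy w (Z s) q = exp (edge_sum w (\<lambda>\<kappa> i. corner_log (F i) \<kappa>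
          (Z s i - of_real (F i))) q) * of_real (edge_holonomy w F q)"
        by (rule edge_holonomy_exp)
      also have "edge_holonomy w F q = 1" using F_edge[OF F s(2)] by (simp add: edge_holonomy_def)
      finally show ?thesis by (simp add: sum_0[OF s])
    qed
  qed
qed

end

section \<open>Hyperbolic structures\<close>

interpretation complex_log: log_near_one "\<lambda>d. Ln (1 + d)"
  by (rule log_near_one_Ln)

lemma Im_shape_pos:
  assumes "0 < Im z"
  shows "0 < Im (shape \<kappa> z)"
proof -
  have z: "z \<noteq> 0" "1 - z \<noteq> 0" using assms by (auto simp: complex_eq_iff)
  show ?thesis
  proof (cases \<kappa> rule: corner_letter_cases)
    case 2
    have "shape_x z = 1 - 1 / z" using z by (simp add: shape_x_def field_simps)
    then show ?thesis using assms z by (simp add: 2 Im_divide sum_power2_gt_zero_iff complex_eq_iff)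
  next
    case 3
    show ?thesis
      using assms z by (simp add: 3 shape_y_def Im_divide sum_power2_gt_zero_iff complex_eq_iff)
  qed (use assms in simp)
qed

text \<open>The numbers \<open>z / a\<close> and \<open>(1 - z) / (1 - a)\<close> have positive real part, so their logarithms contribute
  less than \<open>\<pi> / 2\<close> each.\<close>

lemma Im_corner_log_bound:
  assumes "norm d < \<bar>a\<bar>" "norm d < \<bar>1 - a\<bar>"
  shows "\<bar>Im (complex_log.corner_log a \<kappa> d)\<bar> < pi"
proof -
  have bound: "\<bar>Im (Ln (1 + e))\<bar> < pi / 2" if "norm e < 1" for e
  proof -
    have "0 < Re (1 + e)" using abs_Re_le_cmod[of e] that by simp
    moreover from this have "1 + e \<noteq> 0" by (metis less_irrefl zero_complex.simps(1))
    ultimately show ?thesis using Re_Ln_pos_lt[of "1 + e"] by blast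
  qed
  have m: "- 1 / (1 - a) = 1 / - (1 - a)" by (simp only: divide_minus_left divide_minus_right)
  have "\<bar>Im (Ln (1 + of_real (1 / a) * d))\<bar> < pi / 2" "\<bar>Im (Ln (1 + of_real (- 1 / (1 - a)) * d))\<bar> < pi / 2"
    unfolding m using assms by (intro bound norm_scaled_less_one; simp)+
  then have im: "\<bar>Im (Ln (1 + of_real (1 / a) * d))\<bar> < pi"
      "\<bar>- Im (Ln (1 + of_real (- 1 / (1 - a)) * d))\<bar> < pi"
      "\<bar>Im (Ln (1 + of_real (- 1 / (1 - a)) * d)) + - Im (Ln (1 + of_real (1 / a) * d))\<bar> < pi"
    by linarith+
  show ?thesis
    by (cases \<kappa> rule: corner_letter_cases) (simp_all only: complex_log.corner_log_def corner.case letter.case plus_complex.simps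
        uminus_complex.simps im)
qed

text \<open>Along the deformation the argument of a factor starts at \<open>0\<close> or \<open>\<pi>\<close> according to the sign of its
  real value. It stays equal to this value plus the imaginary part of the continued logarithm,
  because the factor remains in the upper half plane and that imaginary part is less than \<open>\<pi>\<close> in
  absolute value.\<close>

lemma Arg_shape:
  assumes a: "a \<noteq> 0" "a \<noteq> 1" and close: "norm (z - of_real a) < \<bar>a\<bar>" "norm (z - of_real a) < \<bar>1 - a\<bar>"
    and z: "0 < Im z"
  shows "Arg (shape \<kappa> z) = Im (complex_log.corner_log a \<kappa> (z - of_real a)) + (if shape \<kappa> a < 0 then pi else 0)"
proof -
  define l where "l = complex_log.corner_log a \<kappa> (z - of_real a)"
  have l: "\<bar>Im l\<bar> < pi" unfolding l_def by (rule Im_corner_log_bound[OF close])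
  have e: "shape \<kappa> z = exp l * of_real (shape \<kappa> a)"
    using complex_log.exp_corner_log[OF a close] by (simp add: l_def)
  have im: "0 < exp (Re l) * sin (Im l) * shape \<kappa> a"
    using Im_shape_pos[OF z, of \<kappa>] by (simp add: e Im_exp)
  show ?thesis
  proof (cases "shape \<kappa> a < 0")
    case True
    then have "sin (Im l) < 0"
      using im by (auto simp: zero_less_mult_iff mult_less_0_iff)
    then have "Im l < 0"
      using sin_ge_zero[of "Im l"] l by (metis abs_less_iff less_eq_real_def linorder_not_less)
    have "shape \<kappa> z = exp (l + \<i> * of_real pi) * of_real (- shape \<kappa> a)"
      by (simp add: e exp_add)
    then have "Arg (shape \<kappa> z) = Arg (exp (l + \<i> * of_real pi))"
      using True by (simp only: Arg_times_of_real2 neg_0_less_iff_less)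
    also have "\<dots> = Im l + pi"
      using l \<open>Im l < 0\<close> by (subst Arg_exp) auto
    finally show ?thesis using True by (simp add: l_def)
  next
    case False
    then have "0 < shape \<kappa> a" using im by (cases "shape \<kappa> a = 0") auto
    then have "Arg (shape \<kappa> z) = Arg (exp l)" by (simp only: e Arg_times_of_real2)
    also have "\<dots> = Im l" using l by (subst Arg_exp) auto
    finally show ?thesis using False by (simp add: l_def)
  qed
qed

lemma collapses_toI:
  assumes cont: "\<And>j. continuous_on {0..} (\<lambda>t. Z t j)" and start: "\<And>j. Z 0 j = of_real (z j)"
  shows "collapses_to w Z z"
  unfolding collapses_to_def
proof (intro allI impI conjI)
  fix j
  show "continuous_on {0<..} (\<lambda>t. Z t j)"
    using cont[of j] by (rule continuous_on_subset) auto
  have "((\<lambda>t. Z t j) \<longlongrightarrow> Z 0 j) (at 0 within {0..})"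
    using cont[of j] by (simp add: continuous_on_def)
  then show "((\<lambda>t. Z t j) \<longlongrightarrow> of_real (z j)) (at_right 0)"
    unfolding start by (rule tendsto_within_subset) auto
qed

context cyclic_word
begin

text \<open>The curve of complex solutions is followed along the imaginary axis. The parameter is stopped inside
  the disc over which the curve is defined, as structures are required for all \<open>t > 0\<close>.\<close>

lemma hyperbolic_collapse:
  assumes F: "F \<in> V_plus w"
  shows "\<exists>H. (\<forall>t>0. hyperbolic_structure w (H t)) \<and> collapses_to w H F"
proof -
  obtain v where v: "positive_kernel F v" using positive_kernel_exists[OF F] .
  obtain \<delta> and Z :: "complex \<Rightarrow> nat \<Rightarrow> complex" where \<delta>: "0 < \<delta>"
    and Z: "\<And>i. continuous_on (ball 0 \<delta>) (\<lambda>s. Z s i)" "\<And>i. Z 0 i = of_real (F i)"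
      "\<And>s i. norm s < \<delta> \<Longrightarrow> i < N \<Longrightarrow> \<exists>\<theta>. Z s i = of_real (F i) + s * (of_real (v i) + \<theta>) \<and> norm \<theta> < v i"
      "\<And>s i. norm s < \<delta> \<Longrightarrow> i < N \<Longrightarrow> norm (Z s i - of_real (F i)) < \<bar>F i\<bar>"
      "\<And>s i. norm s < \<delta> \<Longrightarrow> i < N \<Longrightarrow> norm (Z s i - of_real (F i)) < \<bar>1 - F i\<bar>"
      "\<And>s q. norm s < \<delta> \<Longrightarrow> q < N \<Longrightarrow>
        edge_sum w (\<lambda>\<kappa> i. complex_log.corner_log (F i) \<kappa> (Z s i - of_real (F i))) q = 0"
      "\<And>s q. norm s < \<delta> \<Longrightarrow> q < N \<Longrightarrow> edge_holonomy w (Z s) q = 1"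
    by (rule solution_curve[OF F log_near_one_Ln v]) (rule that; assumption)
  define \<sigma> where "\<sigma> t = \<i> * of_real (min t (\<delta> / 2))" for t :: real
  have \<sigma>: "norm (\<sigma> t) < \<delta>" if "0 \<le> t" for t using that \<delta> by (simp add: \<sigma>_def norm_mult)
  have \<sigma>_cont: "continuous_on {0..} \<sigma>" unfolding \<sigma>_def by (intro continuous_intros)
  define H where "H t = Z (\<sigma> t)" for t
  have "hyperbolic_structure w (H t)" if t: "0 < t" for t
  proof -
    have s: "norm (\<sigma> t) < \<delta>" using \<sigma>[of t] t by simp
    have Im: "0 < Im (H t i)" if i: "i < N" for i
    proof -
      obtain \<theta> where \<theta>: "H t i = of_real (F i) + \<sigma> t * (of_real (v i) + \<theta>)" "norm \<theta> < v i"
        using Z(3)[OF s i] by (auto simp: H_def)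
      have "0 < v i + Re \<theta>" using \<theta>(2) abs_Re_le_cmod[of \<theta>] by linarith
      then show ?thesis using t \<delta> by (simp add: \<theta>(1) \<sigma>_def)
    qed
    have "sum_list (map Arg (edge_factors w (H t) q)) = 2 * pi" if q: "q < N" for q
    proof -
      have "sum_list (map Arg (edge_factors w (H t) q)) = edge_sum w (\<lambda>\<kappa> i. Arg (shape \<kappa> (H t i))) q"
        unfolding edge_factors_eq edge_sum_def map_map
        by (intro arg_cong[of _ _ sum_list] map_cong) auto
      also have "\<dots> = edge_sum w (\<lambda>\<kappa> i. Im (complex_log.corner_log (F i) \<kappa> (H t i - of_real (F i)))
          + (if shape \<kappa> (F i) < 0 then pi else 0)) q"
      proof (rule edge_sum_cong)
        fix \<kappa> i assume i: "i < N"
        show "Arg (shape \<kappa> (H t i)) = Im (complex_log.corner_log (F i) \<kappa> (H t i - of_real (F i)))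
          + (if shape \<kappa> (F i) < 0 then pi else 0)"
          using F_pos[OF F i] F_neq_1[OF F i] Z(4,5)[OF s i] Im[OF i]
          by (intro Arg_shape) (auto simp: H_def)
      qed
      also have "\<dots> = Im (edge_sum w (\<lambda>\<kappa> i. complex_log.corner_log (F i) \<kappa> (H t i - of_real (F i))) q)
          + pi * real (edge_sum w (\<lambda>\<kappa> i. if shape \<kappa> (F i) < 0 then 1 else 0) q)"
      proof -
        have "(\<Sum>(\<kappa>, i)\<leftarrow>ks. Im (f \<kappa> i) + (if P \<kappa> i then pi else 0))
            = Im (\<Sum>(\<kappa>, i)\<leftarrow>ks. f \<kappa> i) + pi * real (\<Sum>(\<kappa>, i)\<leftarrow>ks. if P \<kappa> i then 1 else 0)"
          for ks P and f :: "corner \<Rightarrow> nat \<Rightarrow> complex"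
          by (induction ks) (auto simp: algebra_simps)
        then show ?thesis by (simp only: edge_sum_def)
      qed
      also have "edge_sum w (\<lambda>\<kappa> i. if shape \<kappa> (F i) < 0 then 1 else 0) q = (2::nat)"
        using F_negative[OF F q] count_negative_factors[OF F] by simp
      finally show ?thesis using Z(6)[OF s q] by (simp add: H_def)
    qed
    moreover have "H t i \<noteq> 0 \<and> H t i \<noteq> 1" if "i < N" for i
      using Im[OF that] by auto
    ultimately show ?thesis
      unfolding hyperbolic_structure_def positive_complex_solution_def edge_equations_def
      using Im Z(7)[OF s] by (simp add: H_def N_def)
  qed
  moreover have "collapses_to w H F"
  proof (rule collapses_toI)
    fix j
    show "continuous_on {0..} (\<lambda>t. H t j)"
      unfolding H_def
      by (rule continuous_on_compose2[OF Z(1) \<sigma>_cont]) (use \<sigma> in auto)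
    show "H 0 j = of_real (F j)" using \<delta> Z(2) by (simp add: H_def \<sigma>_def)
  qed
  ultimately show ?thesis by blast
qed

end

section \<open>Anti de Sitter structures\<close>

text \<open>The pseudo-complex number with null coordinates \<open>a\<close> and \<open>b\<close>, the coefficients with respect to the
  idempotents \<open>(1 + \<tau>) / 2\<close> and \<open>(1 - \<tau>) / 2\<close>; in them the ring operations are componentwise.\<close>

definition null_coords :: "real \<Rightarrow> real \<Rightarrow> pcomplex" where
  "null_coords a b = PComplex ((a + b) / 2) ((a - b) / 2)"

lemma null_coords_mult: "null_coords a b * null_coords c d = null_coords (a * c) (b * d)"
  by (simp add: null_coords_def times_pcomplex_def field_simps)

lemma null_coords_one: "null_coords 1 1 = 1"
  by (simp add: null_coords_def one_pcomplex_def)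

lemma null_coords_diff: "null_coords a b - null_coords c d = null_coords (a - c) (b - d)"
  by (simp add: null_coords_def minus_pcomplex_def field_simps)

lemma psqmod_null_coords: "psqmod (null_coords a b) = a * b"
  by (simp add: psqmod_def null_coords_def power2_eq_square field_simps)

lemma null_coords_divide:
  assumes "c \<noteq> 0" "d \<noteq> 0"
  shows "null_coords a b / null_coords c d = null_coords (a / c) (b / d)"
proof -
  have "inverse (null_coords c d) = null_coords (1 / c) (1 / d)"
    unfolding inverse_pcomplex_def psqmod_null_coords using assms by (simp add: null_coords_def field_simps)
  then show ?thesis by (simp add: divide_pcomplex_def null_coords_mult)
qed

lemma shape_null_coords:
  assumes "a \<noteq> 0" "a \<noteq> 1" "b \<noteq> 0" "b \<noteq> 1"
  shows "shape \<kappa> (null_coords a b) = null_coords (shape \<kappa> a) (shape \<kappa> b)"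
proof -
  show ?thesis
    using assms by (cases \<kappa> rule: corner_letter_cases) (simp_all add: shape_x_def shape_y_def null_coords_one[symmetric]
        null_coords_diff null_coords_divide)
qed

lemma prod_list_null_coords:
  "(\<Prod>k\<leftarrow>ks. null_coords (f k) (g k)) = null_coords (\<Prod>k\<leftarrow>ks. f k) (\<Prod>k\<leftarrow>ks. g k)"
  by (induction ks) (simp_all add: null_coords_one null_coords_mult)

lemma continuous_on_null_coords:
  assumes "continuous_on S f" "continuous_on S g"
  shows "continuous_on S (\<lambda>t. null_coords (f t) (g t))"
proof -
  have "null_coords a b = of_real ((a + b) / 2) + ((a - b) / 2) *\<^sub>R PComplex 0 1" for a b
    by (simp only: null_coords_def of_real_pcomplex scaleR_pcomplex_def plus_pcomplex_def pcomplex.sel) simp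
  then show ?thesis using assms by (simp only:) (intro continuous_intros; simp)
qed

context cyclic_word
begin

text \<open>The null coordinates follow the curve of real solutions in opposite directions from \<open>F\<close>. Both keep
  the signs of all factors of \<open>F\<close>, and the real part is their mean, so the same factors have negative
  real part as at \<open>F\<close>.\<close>

lemma AdS_collapse:
  assumes F: "F \<in> V_plus w"
  shows "\<exists>A. (\<forall>t>0. AdS_structure w (A t)) \<and> collapses_to w A F"
proof -
  obtain v where v: "positive_kernel F v" using positive_kernel_exists[OF F] .
  obtain \<delta> and Z :: "real \<Rightarrow> nat \<Rightarrow> real" where \<delta>: "0 < \<delta>"
    and Z_cont: "\<And>i. continuous_on (ball 0 \<delta>) (\<lambda>s. Z s i)" and Z_0: "\<And>i. Z 0 i = of_real (F i)"
    and Z_dir: "\<And>s i. norm s < \<delta> \<Longrightarrow> i < N \<Longrightarrow> \<exists>\<theta>. Z s i = of_real (F i) + s * (of_real (v i) + \<theta>) \<and> norm \<theta> < v i"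
    and Z_close: "\<And>s i. norm s < \<delta> \<Longrightarrow> i < N \<Longrightarrow> norm (Z s i - of_real (F i)) < \<bar>F i\<bar>"
      "\<And>s i. norm s < \<delta> \<Longrightarrow> i < N \<Longrightarrow> norm (Z s i - of_real (F i)) < \<bar>1 - F i\<bar>"
    and "\<And>s q. norm s < \<delta> \<Longrightarrow> q < N \<Longrightarrow>
        edge_sum w (\<lambda>\<kappa> i. log_near_one.corner_log (\<lambda>d. ln (1 + d)) (F i) \<kappa> (Z s i - of_real (F i))) q = 0"
    and Z_edge: "\<And>s q. norm s < \<delta> \<Longrightarrow> q < N \<Longrightarrow> edge_holonomy w (Z s) q = 1"
    by (rule solution_curve[OF F log_near_one_ln v]) (rule that; assumption)
  note Z = Z_cont Z_0[unfolded of_real_eq_id id_apply] Z_dir[unfolded of_real_eq_id id_apply real_norm_def]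
    Z_close[unfolded of_real_eq_id id_apply real_norm_def] Z_edge[unfolded real_norm_def]
  define \<sigma> where "\<sigma> t = min t (\<delta> / 2)" for t :: real
  have \<sigma>: "\<bar>\<sigma> t\<bar> < \<delta>" "\<bar>- \<sigma> t\<bar> < \<delta>" if "0 \<le> t" for t using that \<delta> by (auto simp: \<sigma>_def)
  have \<sigma>_cont: "continuous_on {0..} \<sigma>" "continuous_on {0..} (\<lambda>t. - \<sigma> t)"
    unfolding \<sigma>_def by (intro continuous_intros)+
  define A where "A t i = null_coords (Z (\<sigma> t) i) (Z (- \<sigma> t) i)" for t i
  have "AdS_structure w (A t)" if t: "0 < t" for t
  proof -
    let ?s = "\<sigma> t"
    have s: "\<bar>?s\<bar> < \<delta>" "\<bar>- ?s\<bar> < \<delta>" using \<sigma>[of t] t by auto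
    have side: "0 < Z u i \<and> (Z u i < 1 \<longleftrightarrow> F i < 1) \<and> Z u i \<noteq> 1" if "\<bar>u\<bar> < \<delta>" "i < N" for u i
      using Z(4,5)[OF that] F_pos[OF F that(2)] F_neq_1[OF F that(2)] by linarith
    have sign: "shape \<kappa> (Z u i) \<noteq> 0 \<and> (shape \<kappa> (Z u i) < 0 \<longleftrightarrow> shape \<kappa> (F i) < 0)"
      if "\<bar>u\<bar> < \<delta>" "i < N" for u i \<kappa>
    proof -
      have "shape \<kappa> (Z u i) \<noteq> 0"
      proof -
        show ?thesis using side[OF that]
          by (cases \<kappa> rule: corner_letter_cases) (auto simp: shape_x_def shape_y_def)
      qed
      then show ?thesis
        using side[OF that] F_pos[OF F that(2)] F_neq_1[OF F that(2)] by (simp add: shape_sign(2))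
    qed
    have shapes: "shape \<kappa> (A t i) = null_coords (shape \<kappa> (Z ?s i)) (shape \<kappa> (Z (- ?s) i))" if "i < N" for \<kappa> i
      using side[OF s(1) that] side[OF s(2) that] unfolding A_def by (intro shape_null_coords) auto
    have factors: "edge_factors w (A t) q = map (\<lambda>(\<kappa>, i). null_coords (shape \<kappa> (Z ?s i)) (shape \<kappa> (Z (- ?s) i))) (edge_corners w q)" for q
      unfolding edge_factors_eq using shapes edge_corners_less by (intro map_cong) auto
    have "edge_holonomy w (A t) q = 1" if q: "q < N" for q
    proof -
      have "edge_holonomy w (A t) q = null_coords (edge_holonomy w (Z ?s) q) (edge_holonomy w (Z (- ?s)) q)"
        unfolding edge_holonomy_def factors unfolding edge_factors_eq case_prod_beta
        by (rule prod_list_null_coords)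
      then show ?thesis using Z(6)[OF s(1) q] Z(6)[OF s(2) q] by (simp add: null_coords_one)
    qed
    moreover have "length (filter (\<lambda>f. pRe f < 0) (edge_factors w (A t) q)) = 2" if q: "q < N" for q
    proof -
      have "pRe (null_coords (shape \<kappa> (Z ?s i)) (shape \<kappa> (Z (- ?s) i))) < 0 \<longleftrightarrow> shape \<kappa> (F i) < 0" if "i < N" for \<kappa> i
        using sign[OF s(1) that, of \<kappa>] sign[OF s(2) that, of \<kappa>] by (auto simp: null_coords_def)
      then have "length (filter (\<lambda>f. pRe f < 0) (edge_factors w (A t) q)) = length (filter (\<lambda>f. f < 0) (edge_factors w F q))"
        unfolding factors unfolding edge_factors_eq filter_map length_map comp_def case_prod_beta
        using edge_corners_less by (intro arg_cong[of _ _ length] filter_cong) auto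
      then show ?thesis using F_negative[OF F q] by simp
    qed
    moreover have "psqmod (A t i) > 0 \<and> psqmod (1 - A t i) > 0" if i: "i < N" for i
    proof -
      have "1 - A t i = null_coords (1 - Z ?s i) (1 - Z (- ?s) i)"
        by (simp add: A_def null_coords_one[symmetric] null_coords_diff)
      then show ?thesis
        using side[OF s(1) i] side[OF s(2) i] by (auto simp: A_def psqmod_null_coords zero_less_mult_iff)
    qed
    moreover have "pIm (A t i) > 0" if i: "i < N" for i
    proof -
      obtain \<theta> \<theta>' where th: "Z ?s i = F i + ?s * (v i + \<theta>)" "\<bar>\<theta>\<bar> < v i"
        "Z (- ?s) i = F i + - ?s * (v i + \<theta>')" "\<bar>\<theta>'\<bar> < v i"
        using Z(3)[OF s(1) i] Z(3)[OF s(2) i] by blast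
      have "0 < ?s" using t \<delta> by (simp add: \<sigma>_def)
      then have "0 < ?s * (v i + \<theta>)" "0 < ?s * (v i + \<theta>')" using th by (auto intro!: mult_pos_pos)
      then show ?thesis using th(1,3) by (simp add: A_def null_coords_def)
    qed
    ultimately show ?thesis
      unfolding AdS_structure_def pcomplex_solution_def edge_equations_def by (simp add: N_def)
  qed
  moreover have "collapses_to w A F"
  proof (rule collapses_toI)
    fix j
    show "continuous_on {0..} (\<lambda>t. A t j)"
      unfolding A_def
      by (intro continuous_on_null_coords continuous_on_compose2[OF Z(1) \<sigma>_cont(1)]
          continuous_on_compose2[OF Z(1) \<sigma>_cont(2)]) (use \<sigma> in auto)
    show "A 0 j = of_real (F j)" using \<delta> Z(2) by (simp add: A_def \<sigma>_def null_coords_def of_real_pcomplex)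
  qed
  ultimately show ?thesis by blast
qed

end

theorem theorem2:
  fixes \<phi> :: "int^2^2" and w :: "letter list" and F :: "nat \<Rightarrow> real"
  assumes "anosov \<phi>"
    and "monodromy_word \<phi> w"
    and "F \<in> V_plus w"
  shows "\<exists>(H :: real \<Rightarrow> nat \<Rightarrow> complex) (A :: real \<Rightarrow> nat \<Rightarrow> pcomplex).
           (\<forall>t>0. hyperbolic_structure w (H t)) \<and>
           (\<forall>t>0. AdS_structure w (A t)) \<and>
           collapses_to w H F \<and>
           collapses_to w A F"
proof -
  have "cyclic_word w"
    using assms(2) by (auto simp: monodromy_word_def intro: RL_word_cyclic)
  then show ?thesis
    using cyclic_word.hyperbolic_collapse[OF _ assms(3)] cyclic_word.AdS_collapse[OF _ assms(3)] by blast
qed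

end
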